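(* Let $n\ge 2$ and let $B(0,1)\subset\mathbf{R}^n$ be the open unit ball. There exists an elliptic $A \in C(B(0,1); \mathbf{R}^{n \times n})$ such that the problem $$-\operatorname{div}(A\nabla u)=0 \ \text{ in } B(0,1),\qquad u=0\ \text{ on }\partial B(0,1),$$ has a nontrivial solution, i.e. there is a function $u\in W^{1,1}(B(0,1))$ which is not almost everywhere zero, is a weak solution of $-\operatorname{div}(A\nabla u)=0$ in $B(0,1)$, and has zero trace on $\partial B(0,1)$.
   Context: Functions are real-valued. For an open set $\Omega\subset\mathbf{R}^n$, a bounded measurable map $A:\Omega\to\mathbf{R}^{n\times n}$ is called elliptic if $A(x)$ is a symmetric matrix for every $x\in\Omega$ and there exist constants $\lambda,\Lambda>0$ such that $\lambda|\xi|^2\le (A(x)\xi)\cdot\xi\le\Lambda|\xi|^2$ for every $x\in\Omega$ and $\xi\in\mathbf{R}^n$. A function $u\in W^{1,1}_{\mathrm{loc}}(\Omega)$ is a weak solution of $-\operatorname{div}(A\nabla u)=0$ in $\Omega$ if $\int_\Omega (A\nabla u)\cdot\nabla\varphi=0$ for every $\varphi\in C^1_c(\Omega)$. *)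

theory Defs
  imports "HOL-Analysis.Analysis"
begin

definition elliptic :: "(real^'n) set \<Rightarrow> (real^'n \<Rightarrow> real^'n^'n) \<Rightarrow> bool" where
  "elliptic \<Omega> A \<longleftrightarrow>
     A \<in> borel_measurable (lebesgue_on \<Omega>) \<and> bounded (A ` \<Omega>) \<and>
     (\<forall>x\<in>\<Omega>. transpose (A x) = A x) \<and>
     (\<exists>l L. l > 0 \<and> L > 0 \<and>
       (\<forall>x\<in>\<Omega>. \<forall>\<xi>. l * (norm \<xi>)\<^sup>2 \<le> (A x *v \<xi>) \<bullet> \<xi> \<and> (A x *v \<xi>) \<bullet> \<xi> \<le> L * (norm \<xi>)\<^sup>2))"

text \<open>Gradients, classical and weak, are carried as an explicit second function. The classical one
  is determined by the function, the weak one up to a null set, so none of the definitions below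
  depends on the choice.\<close>

definition C1_gradient :: "(real^'n \<Rightarrow> real) \<Rightarrow> (real^'n \<Rightarrow> real^'n) \<Rightarrow> bool" where
  "C1_gradient f Df \<longleftrightarrow> (\<forall>x. GDERIV f x :> Df x) \<and> continuous_on UNIV Df"

text \<open>Elements of \<open>C\<^sup>1\<^sub>c(\<Omega>)\<close> are identified with their extensions by zero to the whole space.\<close>

definition C1c_gradient ::
    "(real^'n) set \<Rightarrow> (real^'n \<Rightarrow> real) \<Rightarrow> (real^'n \<Rightarrow> real^'n) \<Rightarrow> bool" where
  "C1c_gradient \<Omega> \<phi> D\<phi> \<longleftrightarrow>
     C1_gradient \<phi> D\<phi> \<and> compact (closure {x. \<phi> x \<noteq> 0}) \<and> closure {x. \<phi> x \<noteq> 0} \<subseteq> \<Omega>"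

definition locally_integrable_on ::
    "(real^'n \<Rightarrow> 'b::euclidean_space) \<Rightarrow> (real^'n) set \<Rightarrow> bool" where
  "locally_integrable_on f \<Omega> \<longleftrightarrow> (\<forall>K. compact K \<and> K \<subseteq> \<Omega> \<longrightarrow> f absolutely_integrable_on K)"

definition weak_gradient ::
    "(real^'n) set \<Rightarrow> (real^'n \<Rightarrow> real) \<Rightarrow> (real^'n \<Rightarrow> real^'n) \<Rightarrow> bool" where
  "weak_gradient \<Omega> u Du \<longleftrightarrow>
     locally_integrable_on u \<Omega> \<and> locally_integrable_on Du \<Omega> \<and>
     (\<forall>\<phi> D\<phi>. C1c_gradient \<Omega> \<phi> D\<phi> \<longrightarrow>
       (LINT x|lebesgue_on \<Omega>. u x *\<^sub>R D\<phi> x) = - (LINT x|lebesgue_on \<Omega>. \<phi> x *\<^sub>R Du x))"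

definition W11_loc :: "(real^'n) set \<Rightarrow> (real^'n \<Rightarrow> real) set" where
  "W11_loc \<Omega> = {u. \<exists>Du. weak_gradient \<Omega> u Du}"

definition W11 :: "(real^'n) set \<Rightarrow> (real^'n \<Rightarrow> real) set" where
  "W11 \<Omega> = {u. u absolutely_integrable_on \<Omega> \<and>
              (\<exists>Du. weak_gradient \<Omega> u Du \<and> Du absolutely_integrable_on \<Omega>)}"

definition weak_solution ::
    "(real^'n) set \<Rightarrow> (real^'n \<Rightarrow> real^'n^'n) \<Rightarrow> (real^'n \<Rightarrow> real) \<Rightarrow> bool" where
  "weak_solution \<Omega> A u \<longleftrightarrow> u \<in> W11_loc \<Omega> \<and>
     (\<exists>Du. weak_gradient \<Omega> u Du \<and>
       (\<forall>\<phi> D\<phi>. C1c_gradient \<Omega> \<phi> D\<phi> \<longrightarrow>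
         (LINT x|lebesgue_on \<Omega>. (A x *v Du x) \<bullet> D\<phi> x) = 0))"

text \<open>The surface measure of the unit sphere, in polar-coordinate form:
  \<open>\<sigma>(E) = n \<cdot> |{x. 0 < |x| < 1 \<and> x / |x| \<in> E}|\<close>.\<close>

definition sphere_measure :: "(real^'n) measure" where
  "sphere_measure =
     scale_measure (of_nat CARD('n))
       (distr (lebesgue_on (ball 0 1 - {0})) (restrict_space borel (sphere 0 1))
          (\<lambda>x. x /\<^sub>R norm x))"

text \<open>The trace operator \<open>W\<^sup>1\<^sup>,\<^sup>1(B) \<rightarrow> L\<^sup>1(\<partial>B)\<close>, for \<open>B\<close> the unit ball, is the continuous extension of
  the restriction \<open>w \<mapsto> w|\<partial>B\<close> from the dense subspace of (restrictions to the closed ball of) \<open>C\<^sup>1\<close>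
  functions. Accordingly \<open>g\<close> is the trace of \<open>u\<close> if it is the \<open>L\<^sup>1\<close> limit of the boundary values of
  such functions converging to \<open>u\<close> in the norm of \<open>W\<^sup>1\<^sup>,\<^sup>1(B)\<close>.\<close>

definition has_trace :: "(real^'n \<Rightarrow> real) \<Rightarrow> (real^'n \<Rightarrow> real) \<Rightarrow> bool" where
  "has_trace u g \<longleftrightarrow>
     u \<in> W11 (ball 0 1) \<and> integrable sphere_measure g \<and>
     (\<exists>Du w Dw.
        weak_gradient (ball 0 1) u Du \<and> Du absolutely_integrable_on ball 0 1 \<and>
        (\<forall>k::nat. C1_gradient (w k) (Dw k)) \<and>
        (\<lambda>k. LINT x|lebesgue_on (ball 0 1). \<bar>w k x - u x\<bar>) \<longlonglongrightarrow> 0 \<and>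
        (\<lambda>k. LINT x|lebesgue_on (ball 0 1). norm (Dw k x - Du x)) \<longlonglongrightarrow> 0 \<and>
        (\<lambda>k. LINT x|sphere_measure. \<bar>w k x - g x\<bar>) \<longlonglongrightarrow> 0)"

end

theory Submission
  imports Defs
begin

text \<open>
  Write \<open>r = |x|\<close>, \<open>L = 8 - log r\<close> and let \<open>e\<close> be a unit vector.  The dipole \<open>(x \<bullet> e) r\<^sup>-\<^sup>n\<close> is harmonic
  away from the origin, but its gradient, of size \<open>r\<^sup>-\<^sup>n\<close>, just fails to be integrable there.  A factor
  \<open>L\<^sup>-\<^sup>2\<close> repairs this, because \<open>1 / (r log\<^sup>2 r)\<close> is integrable at \<open>0\<close>, and it varies so slowly that the
  equation is violated only by a relative error of order \<open>1 / L\<close>.  Such an error can be absorbed into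
  a coefficient matrix which differs from the identity by \<open>O(1 / L)\<close> and is therefore still continuous
  at the origin.  Subtracting a multiple of the harmonic function \<open>x \<bullet> e\<close> produces the zero boundary
  values.

  To get closed formulas one prescribes the flux \<open>A \<nabla>u\<close> instead of \<open>A\<close>.  Let
  \<open>u = (x \<bullet> e) v(r)\<close> and let \<open>A\<close> act as the identity on the tangent spaces of the spheres around \<open>0\<close>.
  If the radial component of \<open>A \<nabla>u\<close> is \<open>P(r) (x \<bullet> e) / r\<close>, then \<open>div (A \<nabla>u) = 0\<close> away from the origin
  says that \<open>v = P + r P' / (n - 1)\<close>.  The choice \<open>P = - (n - 1) r\<^sup>-\<^sup>n L\<^sup>-\<^sup>2 - k\<close> gives
  \<open>v = r\<^sup>-\<^sup>n (L\<^sup>-\<^sup>2 - 2 L\<^sup>-\<^sup>3) - k\<close>, and \<open>k = 3 / 256\<close> makes \<open>v(1) = 0\<close>.  Then \<open>A\<close> multiplies the radial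
  direction by \<open>P / (v + r v')\<close>, and it turns out that this number lies between \<open>1\<close> and \<open>1 + 8 / L\<close>
  for \<open>0 < r \<le> 1\<close> (lemma \<open>radial_excess_bounds\<close>), so that \<open>A\<close> is elliptic and continuous.

  It remains to see that the origin carries no distributional contribution.  For \<open>u\<close> this follows with
  cutoff functions \<open>\<eta>\<^sub>k\<close> that vanish near \<open>0\<close> and satisfy \<open>|\<nabla>\<eta>\<^sub>k| \<le> 16 / r\<close>, as \<open>u / r\<close> and \<open>\<nabla>u\<close> are
  integrable (\<open>weak_gradient_puncture\<close>); the functions \<open>\<eta>\<^sub>k u\<close>, cut off outside the ball as well, are
  also the smooth approximations that show the trace to be zero (\<open>has_trace_zero_puncture\<close>).  For
  the flux \<open>V = A \<nabla>u\<close>, which is only integrable, the term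
  \<open>\<integral> \<phi> V \<bullet> \<nabla>\<eta>\<^sub>k\<close> needs a cancellation: \<open>V\<close> is even and \<open>\<nabla>\<eta>\<^sub>k\<close> is odd, so \<open>\<phi>\<close> may be replaced by
  \<open>\<phi> - \<phi>(0) = O(r)\<close>, and the integrand is then bounded by a multiple of \<open>|V|\<close>
  (\<open>divergence_free_puncture\<close>).

  In the formal text radial functions are written as functions of \<open>\<rho> = x \<bullet> x = r\<^sup>2\<close>, which avoids
  differentiating the norm.
\<close>

section \<open>Continuously differentiable functions with compact support\<close>

lemma GDERIV_zero_outside_support:
  assumes "GDERIV f x :> D" "x \<notin> closure {x. f x \<noteq> 0}"
  shows "D = 0"
proof -
  define S where "S = - closure {x. f x \<noteq> 0}"
  have S: "open S" "x \<in> S" using assms(2) by (auto simp: S_def)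
  have "f y = 0" if "y \<in> S" for y
    using that closure_subset[of "{x. f x \<noteq> 0}"] unfolding S_def by blast
  then have "0 = f y" if "y \<in> S" for y using that by simp
  then have "(f has_derivative (\<lambda>h. 0)) (at x)"
    by (rule has_derivative_transform_within_open[OF has_derivative_const S])
  moreover have "(f has_derivative (\<lambda>h. h \<bullet> D)) (at x)"
    using assms(1) by (simp add: gderiv_def)
  ultimately have "(\<lambda>h. h \<bullet> D) = (\<lambda>h. 0)"
    by (rule has_derivative_unique[rotated])
  then have "D \<bullet> D = 0" by (rule fun_cong)
  then show ?thesis by simp
qed

lemma C1c_gradient_zero:
  assumes "C1c_gradient \<Omega> \<phi> D\<phi>" "x \<notin> \<Omega>"
  shows "\<phi> x = 0" "D\<phi> x = 0"
proof -
  have x: "x \<notin> closure {x. \<phi> x \<noteq> 0}" using assms by (auto simp: C1c_gradient_def)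
  then show "\<phi> x = 0" using closure_subset[of "{x. \<phi> x \<noteq> 0}"] by blast
  have "GDERIV \<phi> x :> D\<phi> x" using assms(1) by (simp add: C1c_gradient_def C1_gradient_def)
  then show "D\<phi> x = 0" using x by (rule GDERIV_zero_outside_support)
qed

lemma C1_gradient_imp_continuous_on:
  assumes "C1_gradient f Df" shows "continuous_on S f"
proof -
  have "isCont f x" for x
    using assms has_derivative_continuous unfolding C1_gradient_def gderiv_def by blast
  then show ?thesis by (simp add: continuous_at_imp_continuous_on)
qed

lemma C1c_gradient_bound:
  assumes "C1c_gradient \<Omega> \<phi> D\<phi>"
  obtains M where "M > 0" "\<And>x. \<bar>\<phi> x\<bar> \<le> M" "\<And>x. norm (D\<phi> x) \<le> M"
proof -
  let ?S = "closure {x. \<phi> x \<noteq> 0}"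
  have S: "compact ?S" and C1: "C1_gradient \<phi> D\<phi>" using assms by (auto simp: C1c_gradient_def)
  have "bounded (\<phi> ` ?S)"
    by (intro compact_imp_bounded compact_continuous_image S C1_gradient_imp_continuous_on[OF C1])
  then obtain M1 where M1: "\<And>x. x \<in> ?S \<Longrightarrow> \<bar>\<phi> x\<bar> \<le> M1"
    unfolding bounded_iff by (metis imageI real_norm_def)
  have "continuous_on ?S D\<phi>"
    using C1 continuous_on_subset[OF _ subset_UNIV] unfolding C1_gradient_def by blast
  then have "bounded (D\<phi> ` ?S)"
    by (intro compact_imp_bounded compact_continuous_image S)
  then obtain M2 where M2: "\<And>x. x \<in> ?S \<Longrightarrow> norm (D\<phi> x) \<le> M2"
    unfolding bounded_iff by (metis imageI)
  have S': "C1c_gradient ?S \<phi> D\<phi>" using assms unfolding C1c_gradient_def by blast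
  show ?thesis
  proof (rule that[of "max 1 (max M1 M2)"])
    fix x
    show "\<bar>\<phi> x\<bar> \<le> max 1 (max M1 M2)"
      using M1[of x] C1c_gradient_zero(1)[OF S', of x] by linarith
    show "norm (D\<phi> x) \<le> max 1 (max M1 M2)"
    proof (cases "x \<in> ?S")
      case True
      then show ?thesis using M2[of x] by linarith
    next
      case False
      then show ?thesis using C1c_gradient_zero(2)[OF S', of x] by simp
    qed
  qed simp
qed

lemma C1_gradient_lipschitz:
  fixes f :: "real^'n \<Rightarrow> real"
  assumes "C1_gradient f Df" "\<And>x. norm (Df x) \<le> M"
  shows "\<bar>f x - f y\<bar> \<le> M * norm (x - y)"
proof -
  have "norm (f x - f y) \<le> M * norm (x - y)"
  proof (rule differentiable_bound[of UNIV])
    fix z :: "real^'n"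
    show "(f has_derivative (\<lambda>h. h \<bullet> Df z)) (at z within UNIV)"
      using assms(1) by (simp add: C1_gradient_def gderiv_def)
    show "onorm (\<lambda>h. h \<bullet> Df z) \<le> M"
    proof (rule onorm_le)
      fix h
      have "\<bar>h \<bullet> Df z\<bar> \<le> norm h * norm (Df z)" by (rule Cauchy_Schwarz_ineq2)
      also have "\<dots> \<le> norm h * M" using assms(2) by (simp add: mult_left_mono)
      finally show "norm (h \<bullet> Df z) \<le> M * norm h" by (simp add: mult.commute)
    qed
  qed auto
  then show ?thesis by simp
qed

text \<open>The factor \<open>f\<close> may be singular outside \<open>\<Omega>\<close>: the product vanishes near every point outside the support
  of \<open>\<psi>\<close>, whatever junk values \<open>f\<close> and \<open>Df\<close> take there.\<close>

lemma C1c_gradient_mult: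
  fixes f \<psi> :: "real^'n \<Rightarrow> real"
  assumes \<psi>: "C1c_gradient \<Omega> \<psi> D\<psi>" and "open \<Omega>"
    and f: "\<And>x. x \<in> \<Omega> \<Longrightarrow> GDERIV f x :> Df x" and Df: "continuous_on \<Omega> Df"
  shows "C1c_gradient \<Omega> (\<lambda>x. \<psi> x * f x) (\<lambda>x. \<psi> x *\<^sub>R Df x + f x *\<^sub>R D\<psi> x)"
    (is "C1c_gradient \<Omega> ?g ?Dg")
proof -
  define S where "S = closure {x. \<psi> x \<noteq> 0}"
  have C1: "C1_gradient \<psi> D\<psi>" and S: "compact S" "S \<subseteq> \<Omega>"
    using \<psi> by (auto simp: C1c_gradient_def S_def)
  have \<psi>': "C1c_gradient S \<psi> D\<psi>" using \<psi> unfolding C1c_gradient_def S_def by blast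
  note zero = C1c_gradient_zero[OF \<psi>']
  have cover: "UNIV = \<Omega> \<union> - S" using S(2) by blast
  have "GDERIV ?g x :> ?Dg x" for x
  proof (cases "x \<in> \<Omega>")
    case True
    then show ?thesis using f C1 by (auto simp: C1_gradient_def intro: GDERIV_mult)
  next
    case False
    then have x: "x \<in> - S" using S(2) by blast
    have "(?g has_derivative (\<lambda>h. 0)) (at x)"
      by (rule has_derivative_transform_within_open[OF has_derivative_const _ x])
        (use zero(1) S(1) in \<open>auto simp: compact_imp_closed\<close>)
    then show ?thesis using zero x by (simp add: gderiv_def)
  qed
  moreover have "continuous_on UNIV ?Dg"
  proof -
    have "continuous_on \<Omega> f"
      using f by (meson continuous_at_imp_continuous_on gderiv_def has_derivative_continuous)
    then have "continuous_on \<Omega> ?Dg"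
      using C1 Df C1_gradient_imp_continuous_on[OF C1] continuous_on_subset[of UNIV D\<psi> \<Omega>]
      by (intro continuous_intros) (simp_all add: C1_gradient_def)
    moreover have "continuous_on (- S) ?Dg"
      by (rule continuous_on_eq[OF continuous_on_const[of _ 0]]) (use zero in auto)
    ultimately show ?thesis
      unfolding cover using \<open>open \<Omega>\<close> S(1)
      by (intro continuous_on_open_Un) (auto simp: compact_imp_closed)
  qed
  moreover have "closure {x. ?g x \<noteq> 0} \<subseteq> S" unfolding S_def by (rule closure_mono) auto
  ultimately show ?thesis
    unfolding C1c_gradient_def C1_gradient_def
    using S closed_Int_compact[OF closed_closure S(1), of "{x. ?g x \<noteq> 0}"]
    by (metis (lifting) Int_absorb2 subset_trans)
qed

lemma lborel_translate:
  fixes f :: "'a::euclidean_space \<Rightarrow> 'b::{banach, second_countable_topology}"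
  assumes "f \<in> borel_measurable borel"
  shows "integrable lborel (\<lambda>x. f (c + x)) \<longleftrightarrow> integrable lborel f"
    and "(LINT x|lborel. f (c + x)) = (LINT x|lborel. f x)"
proof -
  have "integrable (distr lborel borel ((+) c)) f \<longleftrightarrow> integrable lborel (\<lambda>x. f (c + x))"
    using assms by (intro integrable_distr_eq) auto
  then show "integrable lborel (\<lambda>x. f (c + x)) \<longleftrightarrow> integrable lborel f"
    by (simp add: lborel_distr_plus)
  have "(LINT x|distr lborel borel ((+) c). f x) = (LINT x|lborel. f (c + x))"
    using assms by (intro integral_distr) auto
  then show "(LINT x|lborel. f (c + x)) = (LINT x|lborel. f x)"
    by (simp add: lborel_distr_plus)
qed

lemma integrable_bounded_support:
  fixes f :: "'a::euclidean_space \<Rightarrow> 'b::euclidean_space"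
  assumes "f \<in> borel_measurable borel" "\<And>x. norm (f x) \<le> M" "\<And>x. x \<notin> cball 0 R \<Longrightarrow> f x = 0"
  shows "integrable lborel f"
proof (rule Bochner_Integration.integrable_bound)
  show "integrable lborel (\<lambda>x. M * indicat_real (cball 0 R :: 'a set) x)"
    using emeasure_lborel_cball_finite[of "0::'a" R] by (intro integrable_mult_right integrable_real_indicator) auto
  show "AE x in lborel. norm (f x) \<le> norm (M * indicat_real (cball 0 R) x)"
  proof (rule AE_I2)
    fix x show "norm (f x) \<le> norm (M * indicat_real (cball 0 R) x)"
      using assms(2)[of x] assms(3)[of x] by (cases "x \<in> cball 0 R") auto
  qed
qed (use assms(1) in auto)

text \<open>Integration by parts in its simplest form.  By translation invariance the difference quotients of \<open>f\<close>
  in direction \<open>e\<close> have integral \<open>0\<close>; they are uniformly bounded with a common bounded support, so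
  dominated convergence passes to the derivative.\<close>

lemma integral_C1c_gradient:
  fixes f :: "real^'n \<Rightarrow> real"
  assumes f: "C1c_gradient \<Omega> f Df"
  shows "integrable lborel Df" and "(LINT x|lborel. Df x) = 0"
proof -
  have C1: "C1_gradient f Df" and S: "compact (closure {x. f x \<noteq> 0})" 
    and f': "C1c_gradient (closure {x. f x \<noteq> 0}) f Df"
    using f by (auto simp: C1c_gradient_def)
  obtain M where M: "M > 0" "\<And>x. norm (Df x) \<le> M" "\<And>x. \<bar>f x\<bar> \<le> M"
    using C1c_gradient_bound[OF f] by metis
  obtain R where R: "\<And>x. x \<in> closure {x. f x \<noteq> 0} \<Longrightarrow> norm x \<le> R"
    using S compact_imp_bounded bounded_iff by metis
  have zero: "f x = 0" "Df x = 0" if "norm x > R" for x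
    using C1c_gradient_zero[OF f'] R that by (meson not_le)+
  have fm [measurable]: "f \<in> borel_measurable borel"
    using C1 C1_gradient_imp_continuous_on by (blast intro: borel_measurable_continuous_onI)
  have Dfm [measurable]: "Df \<in> borel_measurable borel"
    using C1 by (auto simp: C1_gradient_def intro: borel_measurable_continuous_onI)
  show int: "integrable lborel Df"
    using M(2) zero by (intro integrable_bounded_support[of Df M R]) auto
  have intf: "integrable lborel f"
    using M(3) zero by (intro integrable_bounded_support[of f M R]) auto
  have "(LINT x|lborel. e \<bullet> Df x) = 0" for e :: "real^'n"
  proof -
    define d where "d k x = (f (e /\<^sub>R real (Suc k) + x) - f x) * real (Suc k)" for k x
    have dm [measurable]: "d k \<in> borel_measurable borel" for k unfolding d_def by measurable
    have d0: "(LINT x|lborel. d k x) = 0" for k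
    proof -
      have "integrable lborel (\<lambda>x. f (e /\<^sub>R real (Suc k) + x))"
        using lborel_translate(1)[OF fm] intf by blast
      then have "(LINT x|lborel. f (e /\<^sub>R real (Suc k) + x) - f x) = 0"
        using intf lborel_translate(2)[OF fm] by simp
      then show ?thesis unfolding d_def by simp
    qed
    have bound: "\<bar>d k x\<bar> \<le> M * norm e * indicat_real (cball 0 (R + norm e)) x" for k x
    proof (cases "x \<in> cball 0 (R + norm e)")
      case True
      have "\<bar>f (e /\<^sub>R real (Suc k) + x) - f x\<bar> \<le> M * (norm e / real (Suc k))"
        using C1_gradient_lipschitz[OF C1 M(2), of "e /\<^sub>R real (Suc k) + x" x]
        by (simp add: divide_inverse mult.commute)
      then have "\<bar>f (e /\<^sub>R real (Suc k) + x) - f x\<bar> * real (Suc k) \<le> M * (norm e / real (Suc k)) * real (Suc k)"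
        by (rule mult_right_mono) simp
      then show ?thesis using True by (simp add: d_def abs_mult)
    next
      case False
      then have x: "norm x > R + norm e" by simp
      have "norm (e /\<^sub>R real (Suc k)) \<le> norm e"
        by (simp add: divide_inverse[symmetric] field_simps) 
      then have "norm (e /\<^sub>R real (Suc k) + x) > R"
        using x norm_diff_ineq[of x "e /\<^sub>R real (Suc k)"] by (simp add: add.commute)
      moreover have "norm x > R" using x norm_ge_zero[of e] by linarith
      ultimately show ?thesis using zero False by (simp add: d_def)
    qed
    have lim: "(\<lambda>k. d k x) \<longlonglongrightarrow> e \<bullet> Df x" for x
    proof -
      have "((\<lambda>t. f (x + t *\<^sub>R e)) has_real_derivative (e \<bullet> Df x)) (at 0)"
      proof -
        have 1: "(f has_derivative (\<lambda>h. h \<bullet> Df x)) (at (x + 0 *\<^sub>R e))"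
          using C1 by (simp add: C1_gradient_def gderiv_def)
        have 2: "((\<lambda>t. x + t *\<^sub>R e) has_derivative (\<lambda>t. t *\<^sub>R e)) (at 0)"
          by (auto intro!: derivative_eq_intros)
        have "((\<lambda>t. f (x + t *\<^sub>R e)) has_derivative (\<lambda>t. (t *\<^sub>R e) \<bullet> Df x)) (at 0)"
          by (rule has_derivative_compose[OF 2 1])
        then show ?thesis by (simp add: has_field_derivative_def mult_commute_abs)
      qed
      then have "((\<lambda>t. (f (x + t *\<^sub>R e) - f x) / t) \<longlongrightarrow> e \<bullet> Df x) (at 0)"
        by (simp add: has_field_derivative_iff)
      moreover have "filterlim (\<lambda>k. inverse (real (Suc k))) (at 0) sequentially"
        unfolding filterlim_at using LIMSEQ_inverse_real_of_nat by auto
      ultimately have "(\<lambda>k. (f (x + inverse (real (Suc k)) *\<^sub>R e) - f x) / inverse (real (Suc k)))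
          \<longlonglongrightarrow> e \<bullet> Df x"
        by (rule filterlim_compose)
      then show ?thesis by (simp add: d_def[abs_def] field_simps)
    qed
    have "(\<lambda>k. LINT x|lborel. d k x) \<longlonglongrightarrow> (LINT x|lborel. e \<bullet> Df x)"
    proof (rule integral_dominated_convergence)
      show "integrable lborel (\<lambda>x. M * norm e * indicat_real (cball 0 (R + norm e) :: (real^'n) set) x)"
        using emeasure_lborel_cball_finite[of "0::real^'n"]
        by (intro integrable_mult_right integrable_real_indicator) auto
    qed (use bound lim in auto)
    then show ?thesis by (simp add: d0 LIMSEQ_const_iff)
  qed
  then have "e \<bullet> (LINT x|lborel. Df x) = 0" for e
    using int by (simp flip: integral_inner_right)
  then show "(LINT x|lborel. Df x) = 0" by (metis inner_eq_zero_iff)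
qed

text \<open>The integrand is the divergence of the field \<open>f(x) x\<close>.\<close>

lemma integral_C1c_euler:
  fixes f :: "real^'n \<Rightarrow> real"
  assumes f: "C1c_gradient \<Omega> f Df" and "open \<Omega>"
  shows "integrable lborel (\<lambda>x. real CARD('n) * f x + x \<bullet> Df x)"
    and "(LINT x|lborel. real CARD('n) * f x + x \<bullet> Df x) = 0"
proof -
  have coord: "GDERIV (\<lambda>x::real^'n. x $ i) x :> axis i 1" for i x
    unfolding gderiv_def inner_axis by (auto intro!: derivative_eq_intros bounded_linear_imp_has_derivative simp: bounded_linear_vec_nth)
  define D where "D i x = f x *\<^sub>R axis i 1 + x $ i *\<^sub>R Df x" for i and x :: "real^'n"
  have D: "C1c_gradient \<Omega> (\<lambda>x. f x * x $ i) (D i)" for i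
    unfolding D_def using coord by (intro C1c_gradient_mult[OF f \<open>open \<Omega>\<close>]) auto
  note int = integral_C1c_gradient[OF D]
  have eq: "real CARD('n) * f x + x \<bullet> Df x = (\<Sum>i\<in>UNIV. D i x \<bullet> axis i 1)" for x
  proof -
    have "D i x \<bullet> axis i 1 = f x + x $ i * Df x $ i" for i
      by (simp add: D_def inner_axis)
    then show ?thesis by (simp add: sum.distrib inner_vec_def)
  qed
  show "integrable lborel (\<lambda>x. real CARD('n) * f x + x \<bullet> Df x)"
    unfolding eq using int(1) by (intro Bochner_Integration.integrable_sum integrable_inner_left) auto
  show "(LINT x|lborel. real CARD('n) * f x + x \<bullet> Df x) = 0"
    unfolding eq using int by (subst Bochner_Integration.integral_sum) (auto simp: integral_inner_left)
qed

section \<open>Cutoff functions\<close>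

definition pos_square :: "real \<Rightarrow> real" where
  "pos_square t = (max 0 t)\<^sup>2"

lemma DERIV_pos_square: "(pos_square has_real_derivative 2 * max 0 t) (at t)"
proof -
  consider "t > 0" | "t < 0" | "t = 0" by linarith
  then show ?thesis
  proof cases
    case 1
    have "((\<lambda>t. t\<^sup>2) has_real_derivative 2 * max 0 t) (at t)"
      using 1 by (auto intro!: derivative_eq_intros)
    then show ?thesis
      by (rule has_field_derivative_transform_within_open[of _ _ _ "{0<..}"])
        (use 1 in \<open>auto simp: pos_square_def\<close>)
  next
    case 2
    have "((\<lambda>t. 0) has_real_derivative 2 * max 0 t) (at t)"
      using 2 by (auto intro!: derivative_eq_intros)
    then show ?thesis
      by (rule has_field_derivative_transform_within_open[of _ _ _ "{..<0}"])
        (use 2 in \<open>auto simp: pos_square_def\<close>)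
  next
    case 3
    have "((\<lambda>h. (pos_square (0 + h) - pos_square 0) / h) \<longlongrightarrow> 0) (at 0)"
    proof (rule Lim_null_comparison)
      show "((\<lambda>h. \<bar>h\<bar>) \<longlongrightarrow> 0) (at (0::real))" by (rule tendsto_rabs_zero) (rule tendsto_ident_at)
      have "norm ((pos_square (0 + h) - pos_square 0) / h) \<le> \<bar>h\<bar>" for h
        by (cases "h > 0") (auto simp: pos_square_def power2_eq_square max_def)
      then show "\<forall>\<^sub>F h in at 0. norm ((pos_square (0 + h) - pos_square 0) / h) \<le> \<bar>h\<bar>" by simp
    qed
    then show ?thesis using 3 by (simp add: DERIV_def)
  qed
qed

text \<open>A composition of two parabola pieces is a \<open>C\<^sup>1\<close> step from \<open>0\<close> on \<open>{..1}\<close> to \<open>1\<close> on \<open>{2..}\<close>: the inner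
  square is at least \<open>1\<close> below \<open>1\<close> and vanishes above \<open>2\<close>.\<close>

definition smooth_step :: "real \<Rightarrow> real" where
  "smooth_step t = pos_square (1 - pos_square (2 - t))"

definition smooth_step' :: "real \<Rightarrow> real" where
  "smooth_step' t = 4 * max 0 (1 - pos_square (2 - t)) * max 0 (2 - t)"

lemma DERIV_smooth_step: "(smooth_step has_real_derivative smooth_step' t) (at t)"
  unfolding smooth_step_def[abs_def] smooth_step'_def
  by (rule DERIV_cong[OF DERIV_chain2[OF DERIV_pos_square DERIV_diff[OF DERIV_const
          DERIV_chain2[OF DERIV_pos_square DERIV_diff[OF DERIV_const DERIV_ident]]]]]) simp

lemma pos_square_nonneg: "0 \<le> pos_square t" by (simp add: pos_square_def)

lemma pos_square_ge_1: "t \<ge> 1 \<Longrightarrow> pos_square t \<ge> 1" by (simp add: pos_square_def)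

lemma smooth_step_nonneg: "0 \<le> smooth_step t"
  and smooth_step_le_1: "smooth_step t \<le> 1"
  and smooth_step_eq_0: "t \<le> 1 \<Longrightarrow> smooth_step t = 0"
  and smooth_step_eq_1: "t \<ge> 2 \<Longrightarrow> smooth_step t = 1"
proof -
  show "0 \<le> smooth_step t" by (simp add: smooth_step_def pos_square_nonneg)
  show "smooth_step t \<le> 1"
    using pos_square_nonneg[of "2 - t"] unfolding smooth_step_def
    by (subst pos_square_def) (auto intro!: power_le_one)
  show "t \<le> 1 \<Longrightarrow> smooth_step t = 0"
    using pos_square_ge_1[of "2 - t"] unfolding smooth_step_def
    by (subst pos_square_def) auto
  show "t \<ge> 2 \<Longrightarrow> smooth_step t = 1"
    unfolding smooth_step_def by (simp add: pos_square_def)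
qed

lemma smooth_step'_nonneg: "0 \<le> smooth_step' t"
  and smooth_step'_le: "smooth_step' t \<le> 4"
  and smooth_step'_eq_0: "t \<le> 1 \<or> t \<ge> 2 \<Longrightarrow> smooth_step' t = 0"
proof -
  show nonneg: "0 \<le> smooth_step' t" by (simp add: smooth_step'_def)
  show eq_0: "smooth_step' t = 0" if "t \<le> 1 \<or> t \<ge> 2" for t
    using that pos_square_ge_1[of "2 - t"] by (auto simp: smooth_step'_def)
  show "smooth_step' t \<le> 4"
  proof (cases "t \<le> 1 \<or> t \<ge> 2")
    case False
    have "max 0 (1 - pos_square (2 - t)) * max 0 (2 - t) \<le> 1 * 1"
      by (rule mult_mono) (use False pos_square_nonneg[of "2 - t"] in auto)
    then show ?thesis by (simp add: smooth_step'_def)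
  qed (use eq_0 in auto)
qed

lemma continuous_on_smooth_step': "continuous_on S smooth_step'"
proof -
  have q: "continuous_on UNIV pos_square"
    using DERIV_pos_square DERIV_isCont continuous_at_imp_continuous_on by blast
  have "continuous_on S (\<lambda>t. pos_square (2 - t))"
    by (rule continuous_on_compose2[OF q]) (auto intro!: continuous_intros)
  then show ?thesis
    unfolding smooth_step'_def[abs_def] by (intro continuous_intros)
qed

lemma GDERIV_radial:
  assumes "(f has_real_derivative D) (at (x \<bullet> x))"
  shows "GDERIV (\<lambda>x. f (x \<bullet> x)) x :> (2 * D) *\<^sub>R x"
proof -
  have "GDERIV (\<lambda>x. x \<bullet> x) x :> 2 *\<^sub>R x"
    unfolding gderiv_def by (auto intro!: derivative_eq_intros simp: inner_commute)
  from GDERIV_DERIV_compose[OF this assms] show ?thesis by (simp add: mult.commute)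
qed

definition cutoff :: "nat \<Rightarrow> 'a::real_inner \<Rightarrow> real" where
  "cutoff k x = smooth_step (real k * (x \<bullet> x))"

definition cutoff_grad :: "nat \<Rightarrow> 'a::real_inner \<Rightarrow> 'a" where
  "cutoff_grad k x = (2 * real k * smooth_step' (real k * (x \<bullet> x))) *\<^sub>R x"

lemma C1_gradient_cutoff: "C1_gradient (cutoff k) (cutoff_grad k)"
  unfolding C1_gradient_def
proof
  have "((\<lambda>t. smooth_step (real k * t)) has_real_derivative real k * smooth_step' (real k * t)) (at t)" for t
    by (rule DERIV_cong[OF DERIV_chain2[OF DERIV_smooth_step DERIV_cmult_Id]]) simp
  from GDERIV_radial[OF this] show "\<forall>x. GDERIV (cutoff k) x :> cutoff_grad k x"
    unfolding cutoff_def[abs_def] cutoff_grad_def by (auto simp: mult.assoc)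
  show "continuous_on UNIV (cutoff_grad k :: real^'a \<Rightarrow> real^'a)"
    unfolding cutoff_grad_def
    by (intro continuous_intros continuous_on_compose2[OF continuous_on_smooth_step'[of UNIV]]) auto
qed

lemma C1_gradient_measurable:
  assumes "C1_gradient f Df"
  shows "f \<in> borel_measurable borel" "Df \<in> borel_measurable borel"
  using assms C1_gradient_imp_continuous_on[OF assms, of UNIV]
  by (auto simp: C1_gradient_def intro: borel_measurable_continuous_onI)

lemmas cutoff_measurable = C1_gradient_measurable[OF C1_gradient_cutoff]

lemma cutoff_bounds: "0 \<le> cutoff k x" "cutoff k x \<le> 1" "\<bar>cutoff k x\<bar> \<le> 1"
  unfolding cutoff_def using smooth_step_nonneg smooth_step_le_1 by (auto simp: abs_of_nonneg)

text \<open>The gradient is supported in the shell \<open>1 \<le> k |x|\<^sup>2 \<le> 2\<close>, on which \<open>k |x|\<close> is comparable to \<open>1 / |x|\<close>.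
  This bound does not depend on \<open>k\<close> and serves for dominated convergence.\<close>

lemma norm_cutoff_grad_le: "norm (cutoff_grad k x) \<le> 16 / norm x"
proof (cases "x = 0")
  case False
  let ?t = "real k * (x \<bullet> x)"
  have "?t * smooth_step' ?t \<le> 2 * 4"
  proof (cases "?t \<le> 2")
    case True
    then show ?thesis by (intro mult_mono smooth_step'_le smooth_step'_nonneg) auto
  next
    case False
    then show ?thesis using smooth_step'_eq_0[of ?t] by simp
  qed
  then have "norm (cutoff_grad k x) * norm x \<le> 16"
    using smooth_step'_nonneg[of ?t]
    by (simp add: cutoff_grad_def dot_square_norm power2_eq_square abs_mult mult_ac)
  then show ?thesis using False by (simp add: field_simps)
qed (simp add: cutoff_grad_def)

text \<open>A bound that is uniform in \<open>x\<close> shows, for each single \<open>k\<close>, that the inner product of this gradient with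
  an integrable field is integrable.\<close>

lemma norm_cutoff_grad_le': "norm (cutoff_grad k x) \<le> 8 * (real k + 2)"
proof -
  let ?t = "real k * (x \<bullet> x)"
  have "smooth_step' ?t * (real k * norm x) \<le> 4 * (real k + 2)"
  proof (cases "?t \<le> 2")
    case True
    have "norm x \<le> 1 + x \<bullet> x"
      using sum_squares_bound[of 1 "norm x"] norm_ge_zero[of x]
      unfolding dot_square_norm one_power2 by linarith
    then have "real k * norm x \<le> real k * (1 + x \<bullet> x)" by (simp add: mult_left_mono)
    also have "\<dots> \<le> real k + 2" using True by (simp add: algebra_simps)
    finally show ?thesis by (intro mult_mono smooth_step'_le) auto
  next
    case False
    then show ?thesis using smooth_step'_eq_0[of ?t] by simp
  qed
  then show ?thesis
    using smooth_step'_nonneg[of ?t] by (simp add: cutoff_grad_def abs_mult mult_ac)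
qed

lemma eventually_cutoff:
  assumes "x \<noteq> 0"
  shows "\<forall>\<^sub>F k in sequentially. cutoff k x = 1 \<and> cutoff_grad k x = 0"
proof -
  obtain N where N: "2 / (x \<bullet> x) \<le> real N" using real_arch_simple by blast
  show ?thesis
    unfolding eventually_sequentially
  proof (intro exI[of _ N] allI impI)
    fix k assume "N \<le> k"
    then have "2 / (x \<bullet> x) \<le> real k" using N by linarith
    then have "2 \<le> real k * (x \<bullet> x)" using assms by (simp add: field_simps)
    then show "cutoff k x = 1 \<and> cutoff_grad k x = 0"
      by (simp add: cutoff_def cutoff_grad_def smooth_step_eq_1 smooth_step'_eq_0)
  qed
qed

text \<open>Cutting off turns test functions on \<open>\<Omega>\<close> into test functions that avoid the singularity.\<close>

lemma C1c_gradient_cutoff_mult: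
  assumes \<phi>: "C1c_gradient \<Omega> \<phi> D\<phi>" and "open \<Omega>"
  shows "C1c_gradient (\<Omega> - {0}) (\<lambda>x. \<phi> x * cutoff k x)
           (\<lambda>x. \<phi> x *\<^sub>R cutoff_grad k x + cutoff k x *\<^sub>R D\<phi> x)"
proof -
  let ?S = "{x. \<phi> x * cutoff k x \<noteq> 0}" and ?T = "{x. 1 \<le> real k * (x \<bullet> x)}"
  have "C1c_gradient \<Omega> (\<lambda>x. \<phi> x * cutoff k x)
         (\<lambda>x. \<phi> x *\<^sub>R cutoff_grad k x + cutoff k x *\<^sub>R D\<phi> x)"
    using C1_gradient_cutoff[of k] 
    by (intro C1c_gradient_mult[OF \<phi> \<open>open \<Omega>\<close>])
     (auto simp: C1_gradient_def intro: continuous_on_subset)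
  moreover have "closure ?S \<subseteq> ?T"
  proof (rule closure_minimal)
    show "?S \<subseteq> ?T" using smooth_step_eq_0[of "real k * (x \<bullet> x)" for x] by (force simp: cutoff_def)
    show "closed ?T" by (intro closed_Collect_le continuous_intros)
  qed
  then have "0 \<notin> closure ?S" by auto
  ultimately show ?thesis unfolding C1c_gradient_def by blast
qed

lemma borel_measurable_lebesgue_onI:
  fixes f :: "'a::euclidean_space \<Rightarrow> 'b::euclidean_space"
  assumes "f \<in> borel_measurable borel"
  shows "f \<in> borel_measurable (lebesgue_on S)"
  using assms by (intro measurable_restrict_space1 measurable_completion) simp

lemma lebesgue_on_eq_lborel:
  fixes f :: "'a::euclidean_space \<Rightarrow> 'b::euclidean_space"
  assumes f: "f \<in> borel_measurable borel" and S: "S \<in> sets lebesgue" "\<And>x. x \<notin> S \<Longrightarrow> f x = 0"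
  shows "integrable (lebesgue_on S) f \<longleftrightarrow> integrable lborel f"
    and "(LINT x|lebesgue_on S. f x) = (LINT x|lborel. f x)"
proof -
  have eq: "(\<lambda>x. indicator S x *\<^sub>R f x) = f" using S(2) by (auto simp: indicator_def)
  show "integrable (lebesgue_on S) f \<longleftrightarrow> integrable lborel f"
    using f S(1) by (simp add: integrable_restrict_space integrable_completion eq)
  show "(LINT x|lebesgue_on S. f x) = (LINT x|lborel. f x)"
    using f S(1) by (simp add: integral_restrict_space integral_completion eq)
qed

lemma integrable_lebesgue_on_iff:
  fixes f :: "'a::euclidean_space \<Rightarrow> 'b::euclidean_space"
  assumes "S \<in> sets lebesgue"
  shows "integrable (lebesgue_on S) f \<longleftrightarrow> f absolutely_integrable_on S"
  using assms by (simp add: integrable_restrict_space set_integrable_def)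

lemma integrable_imp_locally_integrable_on:
  fixes f :: "real^'n \<Rightarrow> 'b::euclidean_space"
  assumes "open \<Omega>" "integrable (lebesgue_on \<Omega>) f"
  shows "locally_integrable_on f \<Omega>"
  unfolding locally_integrable_on_def
proof (intro allI impI)
  fix K assume K: "compact K \<and> K \<subseteq> \<Omega>"
  then have "K \<in> sets lebesgue" by (simp add: lmeasurable_compact fmeasurableD)
  then show "f absolutely_integrable_on K"
    using assms K by (auto simp: integrable_lebesgue_on_iff intro: set_integrable_subset)
qed

lemma AE_lebesgue_on_nonzero:
  assumes "S \<in> sets lebesgue"
  shows "AE x in lebesgue_on S. x \<noteq> (0::'a::euclidean_space)"
proof -
  have "AE x in lebesgue. x \<noteq> (0::'a)"
    by (rule AE_completion) (rule AE_lborel_singleton)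
  then show ?thesis
    using assms by (subst AE_restrict_space_iff) auto
qed

section \<open>Fields with an integrable singularity at the origin\<close>

text \<open>Integrate the gradient of \<open>\<phi> \<eta>\<^sub>k u\<close>, where \<open>\<eta>\<^sub>k\<close> is the cutoff function, and let \<open>k\<close> tend to infinity.  The
  term \<open>\<phi> u \<nabla>\<eta>\<^sub>k\<close> tends to \<open>0\<close> pointwise and is dominated by a multiple of \<open>|u| / |x|\<close>.\<close>

lemma weak_gradient_puncture:
  fixes u :: "real^'n \<Rightarrow> real"
  assumes "open \<Omega>"
    and um: "u \<in> borel_measurable borel" and Dum: "Du \<in> borel_measurable borel"
    and grad: "\<And>x. x \<in> \<Omega> - {0} \<Longrightarrow> GDERIV u x :> Du x" "continuous_on (\<Omega> - {0}) Du"
    and int: "integrable (lebesgue_on \<Omega>) u" "integrable (lebesgue_on \<Omega>) (\<lambda>x. u x / norm x)"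
      "integrable (lebesgue_on \<Omega>) Du"
  shows "weak_gradient \<Omega> u Du"
  unfolding weak_gradient_def
proof (intro conjI allI impI)
  let ?M = "lebesgue_on \<Omega>"
  have \<Omega>: "\<Omega> \<in> sets lebesgue" using \<open>open \<Omega>\<close> by auto
  show "locally_integrable_on u \<Omega>" "locally_integrable_on Du \<Omega>"
    using int \<open>open \<Omega>\<close> by (auto intro: integrable_imp_locally_integrable_on)
  fix \<phi> D\<phi> assume \<phi>: "C1c_gradient \<Omega> \<phi> D\<phi>"
  then have C1: "C1_gradient \<phi> D\<phi>" by (simp add: C1c_gradient_def)
  obtain B where B: "B > 0" "\<And>x. \<bar>\<phi> x\<bar> \<le> B" "\<And>x. norm (D\<phi> x) \<le> B"
    using C1c_gradient_bound[OF \<phi>] by metis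
  note [measurable] = um Dum C1_gradient_measurable[OF C1] cutoff_measurable
  define F where "F k x = (\<phi> x * cutoff k x) *\<^sub>R Du x
      + u x *\<^sub>R (\<phi> x *\<^sub>R cutoff_grad k x + cutoff k x *\<^sub>R D\<phi> x)" for k x
  have Fm: "F k \<in> borel_measurable borel" for k unfolding F_def by measurable
  have F0: "(LINT x|?M. F k x) = 0" for k
  proof -
    have F: "C1c_gradient (\<Omega> - {0}) (\<lambda>x. (\<phi> x * cutoff k x) * u x) (F k)"
      unfolding F_def
      using \<open>open \<Omega>\<close> grad by (intro C1c_gradient_mult C1c_gradient_cutoff_mult \<phi>) auto
    have "(LINT x|?M. F k x) = (LINT x|lborel. F k x)"
      using C1c_gradient_zero(2)[OF F] \<Omega> Fm by (intro lebesgue_on_eq_lborel) auto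
    then show ?thesis using integral_C1c_gradient(2)[OF F] by simp
  qed
  let ?G = "\<lambda>x. \<phi> x *\<^sub>R Du x + u x *\<^sub>R D\<phi> x"
  let ?W = "\<lambda>x. B * norm (Du x) + 16 * B * \<bar>u x / norm x\<bar> + B * \<bar>u x\<bar>"
  have Gm: "?G \<in> borel_measurable borel" by measurable
  have "(\<lambda>k. LINT x|?M. F k x) \<longlonglongrightarrow> (LINT x|?M. ?G x)"
  proof (rule integral_dominated_convergence)
    show "?G \<in> borel_measurable ?M" "F k \<in> borel_measurable ?M" for k
      using Gm Fm by (auto intro: borel_measurable_lebesgue_onI)
    show "integrable ?M ?W"
      using int(1,3) integrable_abs[OF int(2)]
      by (intro Bochner_Integration.integrable_add integrable_mult_right) auto
    show "AE x in ?M. (\<lambda>k. F k x) \<longlonglongrightarrow> ?G x"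
      using AE_lebesgue_on_nonzero[OF \<Omega>]
    proof eventually_elim
      fix x :: "real^'n" assume "x \<noteq> 0"
      show "(\<lambda>k. F k x) \<longlonglongrightarrow> ?G x"
        by (rule tendsto_eventually, rule eventually_mono[OF eventually_cutoff[OF \<open>x \<noteq> 0\<close>]])
          (simp add: F_def)
    qed
    fix k
    have "norm (F k x) \<le> ?W x" for x
    proof -
      have "norm (F k x) \<le> \<bar>\<phi> x\<bar> * \<bar>cutoff k x\<bar> * norm (Du x)
          + \<bar>u x\<bar> * (\<bar>\<phi> x\<bar> * norm (cutoff_grad k x) + \<bar>cutoff k x\<bar> * norm (D\<phi> x))"
        unfolding F_def
        by (intro norm_triangle_le add_mono)
          (auto simp: abs_mult intro!: mult_left_mono norm_triangle_le)
      also have "\<dots> \<le> B * 1 * norm (Du x) + \<bar>u x\<bar> * (B * (16 / norm x) + 1 * B)"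
        using B by (intro add_mono mult_mono mult_left_mono cutoff_bounds norm_cutoff_grad_le) auto
      finally show ?thesis by (simp add: algebra_simps abs_divide)
    qed
    then show "AE x in ?M. norm (F k x) \<le> ?W x" by simp
  qed
  then have G0: "(LINT x|?M. ?G x) = 0"
    by (simp add: F0 LIMSEQ_const_iff)
  have i1: "integrable ?M (\<lambda>x. \<phi> x *\<^sub>R Du x)"
  proof (rule Bochner_Integration.integrable_bound)
    show "integrable ?M (\<lambda>x. B * norm (Du x))" using int(3) by simp
    show "(\<lambda>x. \<phi> x *\<^sub>R Du x) \<in> borel_measurable ?M"
      by (rule borel_measurable_lebesgue_onI) measurable
  qed (use B in \<open>auto simp: abs_mult intro!: AE_I2 mult_right_mono\<close>)
  have i2: "integrable ?M (\<lambda>x. u x *\<^sub>R D\<phi> x)"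
  proof (rule Bochner_Integration.integrable_bound)
    show "integrable ?M (\<lambda>x. \<bar>u x\<bar> * B)" using int(1) by simp
    show "(\<lambda>x. u x *\<^sub>R D\<phi> x) \<in> borel_measurable ?M"
      by (rule borel_measurable_lebesgue_onI) measurable
  qed (use B in \<open>auto simp: abs_mult intro!: AE_I2 mult_left_mono\<close>)
  show "(LINT x|?M. u x *\<^sub>R D\<phi> x) = - (LINT x|?M. \<phi> x *\<^sub>R Du x)"
    using G0 i1 i2 by (simp add: eq_neg_iff_add_eq_0 add.commute)
qed

lemma lborel_integral_reflect:
  fixes f :: "'a::euclidean_space \<Rightarrow> 'b::{banach, second_countable_topology}"
  assumes "f \<in> borel_measurable borel"
  shows "(LINT x|lborel. f (- x)) = (LINT x|lborel. f x)"
proof -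
  have eq: "distr lborel borel uminus = (lborel :: 'a measure)"
    by (subst (2) lborel_affine[of "-1" 0]) (auto simp: density_1)
  have "(LINT x|distr lborel borel uminus. f x) = (LINT x|lborel. f (- x))"
    using assms by (intro integral_distr) auto
  then show ?thesis by (simp add: eq)
qed

text \<open>Here \<open>|V| / |x|\<close> need not be integrable.  Without the symmetry of \<open>V\<close> the divergence could have a
  point mass at the origin, as for \<open>V(x) = x / |x|\<^sup>n\<close>; that this mass vanishes is the oddness of
  \<open>V \<bullet> \<nabla>\<eta>\<^sub>k\<close>.\<close>

lemma divergence_free_puncture:
  fixes V :: "real^'n \<Rightarrow> real^'n"
  assumes "open \<Omega>" and sym: "\<And>x. x \<in> \<Omega> \<Longrightarrow> - x \<in> \<Omega>"
    and Vm: "V \<in> borel_measurable borel" and even: "\<And>x. V (- x) = V x"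
    and int: "integrable (lebesgue_on \<Omega>) V"
    and free: "\<And>\<psi> D\<psi>. C1c_gradient (\<Omega> - {0}) \<psi> D\<psi> \<Longrightarrow> (LINT x|lebesgue_on \<Omega>. V x \<bullet> D\<psi> x) = 0"
    and \<phi>: "C1c_gradient \<Omega> \<phi> D\<phi>"
  shows "(LINT x|lebesgue_on \<Omega>. V x \<bullet> D\<phi> x) = 0"
proof -
  let ?M = "lebesgue_on \<Omega>"
  have \<Omega>: "\<Omega> \<in> sets lebesgue" "\<Omega> \<in> sets borel" using \<open>open \<Omega>\<close> by auto
  have C1: "C1_gradient \<phi> D\<phi>" using \<phi> by (simp add: C1c_gradient_def)
  obtain B where B: "B > 0" "\<And>x. \<bar>\<phi> x\<bar> \<le> B" "\<And>x. norm (D\<phi> x) \<le> B"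
    using C1c_gradient_bound[OF \<phi>] by metis
  note [measurable] = Vm C1_gradient_measurable[OF C1] cutoff_measurable
  define D\<psi> where "D\<psi> k x = \<phi> x *\<^sub>R cutoff_grad k x + cutoff k x *\<^sub>R D\<phi> x" for k x
  have D\<psi>: "C1c_gradient (\<Omega> - {0}) (\<lambda>x. \<phi> x * cutoff k x) (D\<psi> k)" for k
    unfolding D\<psi>_def by (rule C1c_gradient_cutoff_mult[OF \<phi> \<open>open \<Omega>\<close>])
  have [measurable]: "D\<psi> k \<in> borel_measurable borel" for k unfolding D\<psi>_def by measurable
  have int_inner: "integrable ?M (\<lambda>x. V x \<bullet> X x)"
    if [measurable]: "X \<in> borel_measurable borel" and X: "\<And>x. norm (X x) \<le> C" for X C
  proof (rule Bochner_Integration.integrable_bound)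
    show "integrable ?M (\<lambda>x. norm (V x) * C)" using int by simp
    show "(\<lambda>x. V x \<bullet> X x) \<in> borel_measurable ?M"
      by (rule borel_measurable_lebesgue_onI) measurable
    have "\<bar>V x \<bullet> X x\<bar> \<le> norm (V x) * C" for x
      using Cauchy_Schwarz_ineq2[of "V x" "X x"] mult_left_mono[OF X, of "norm (V x)" x] by simp
    then show "AE x in ?M. norm (V x \<bullet> X x) \<le> norm (norm (V x) * C)"
      by (intro AE_I2) (metis abs_ge_self order_trans real_norm_def)
  qed
  have intc: "integrable ?M (\<lambda>x. V x \<bullet> cutoff_grad k x)" for k
    by (rule int_inner[OF _ norm_cutoff_grad_le']) simp
  have int\<psi>: "integrable ?M (\<lambda>x. V x \<bullet> D\<psi> k x)" for k
  proof -
    obtain C where "\<And>x. norm (D\<psi> k x) \<le> C" using C1c_gradient_bound[OF D\<psi>] by metis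
    then show ?thesis by (intro int_inner) auto
  qed
  \<comment> \<open>the value \<open>\<phi>(0)\<close> contributes nothing, by reflection in the origin\<close>
  have odd: "(LINT x|?M. V x \<bullet> cutoff_grad k x) = 0" for k
  proof -
    let ?f = "\<lambda>x. indicat_real \<Omega> x * (V x \<bullet> cutoff_grad k x)"
    have fm: "?f \<in> borel_measurable borel" using \<Omega>(2) by measurable
    have "x \<in> \<Omega> \<longleftrightarrow> - x \<in> \<Omega>" for x using sym[of x] sym[of "- x"] by auto
    then have "?f (- x) = - ?f x" for x
      by (simp add: indicator_def even cutoff_grad_def)
    then have "(LINT x|lborel. ?f x) = - (LINT x|lborel. ?f x)"
      using lborel_integral_reflect[OF fm] by simp
    moreover have "(LINT x|?M. V x \<bullet> cutoff_grad k x) = (LINT x|lborel. ?f x)"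
      using \<Omega>(1) fm by (simp add: integral_restrict_space integral_completion)
    ultimately show ?thesis by simp
  qed
  \<comment> \<open>after this subtraction only \<open>(\<phi> x - \<phi> 0) * (V x \<bullet> cutoff_grad k x)\<close> is left of the singular term\<close>
  define F where "F k x = V x \<bullet> D\<psi> k x - \<phi> 0 * (V x \<bullet> cutoff_grad k x)" for k x
  have [measurable]: "F k \<in> borel_measurable borel" for k unfolding F_def by measurable
  have F0: "(LINT x|?M. F k x) = 0" for k
    unfolding F_def using int\<psi> intc odd free[OF D\<psi>] by simp
  have "(\<lambda>k. LINT x|?M. F k x) \<longlonglongrightarrow> (LINT x|?M. V x \<bullet> D\<phi> x)"
  proof (rule integral_dominated_convergence)
    show "(\<lambda>x. V x \<bullet> D\<phi> x) \<in> borel_measurable ?M" "F k \<in> borel_measurable ?M" for k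
      by (rule borel_measurable_lebesgue_onI, measurable)+
    show "integrable ?M (\<lambda>x. norm (V x) * (17 * B))" using int by simp
    show "AE x in ?M. (\<lambda>k. F k x) \<longlonglongrightarrow> V x \<bullet> D\<phi> x"
      using AE_lebesgue_on_nonzero[OF \<Omega>(1)]
    proof eventually_elim
      fix x :: "real^'n" assume "x \<noteq> 0"
      show "(\<lambda>k. F k x) \<longlonglongrightarrow> V x \<bullet> D\<phi> x"
        by (rule tendsto_eventually, rule eventually_mono[OF eventually_cutoff[OF \<open>x \<noteq> 0\<close>]])
          (simp add: F_def D\<psi>_def)
    qed
    fix k
    have "\<bar>F k x\<bar> \<le> norm (V x) * (17 * B)" for x
    proof -
      let ?X = "(\<phi> x - \<phi> 0) *\<^sub>R cutoff_grad k x + cutoff k x *\<^sub>R D\<phi> x"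
      have "norm ?X \<le> \<bar>\<phi> x - \<phi> 0\<bar> * norm (cutoff_grad k x) + \<bar>cutoff k x\<bar> * norm (D\<phi> x)"
        by (rule norm_triangle_le) simp
      also have "\<dots> \<le> (B * norm x) * (16 / norm x) + 1 * B"
        using B C1_gradient_lipschitz[OF C1 B(3), of x 0]
        by (intro add_mono mult_mono cutoff_bounds norm_cutoff_grad_le) auto
      also have "\<dots> \<le> 17 * B" using B(1) by simp
      finally have "norm ?X \<le> 17 * B" .
      then have "norm (V x) * norm ?X \<le> norm (V x) * (17 * B)" by (rule mult_left_mono) simp
      moreover have "F k x = V x \<bullet> ?X"
        by (simp add: F_def D\<psi>_def inner_add_right inner_diff_left algebra_simps)
      ultimately show ?thesis using Cauchy_Schwarz_ineq2[of "V x" ?X] by simp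
    qed
    then show "AE x in ?M. norm (F k x) \<le> norm (V x) * (17 * B)" by simp
  qed
  then show ?thesis by (simp add: F0 LIMSEQ_const_iff)
qed

text \<open>The approximating functions vanish on the unit sphere exactly: there \<open>u\<close> is \<open>0\<close>, and the cutoffs only
  remove the origin and the region where \<open>u\<close> is no longer differentiable.\<close>

lemma has_trace_zero_puncture:
  fixes u :: "real^'n \<Rightarrow> real"
  assumes um: "u \<in> borel_measurable borel" and Dum: "Du \<in> borel_measurable borel"
    and grad: "\<And>x. x \<in> ball 0 2 - {0} \<Longrightarrow> GDERIV u x :> Du x" "continuous_on (ball 0 2 - {0}) Du"
    and int: "integrable (lebesgue_on (ball 0 1)) u"
      "integrable (lebesgue_on (ball 0 1)) (\<lambda>x. u x / norm x)"
      "integrable (lebesgue_on (ball 0 1)) Du"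
    and boundary: "\<And>x. norm x = 1 \<Longrightarrow> u x = 0"
  shows "has_trace u (\<lambda>x. 0)"
proof -
  let ?B = "ball 0 1 :: (real^'n) set" and ?B2 = "ball 0 2 :: (real^'n) set"
  let ?M = "lebesgue_on ?B"
  have B: "?B \<in> sets lebesgue" by auto
  have weak: "weak_gradient ?B u Du"
    using grad by (intro weak_gradient_puncture um Dum int) (auto intro: continuous_on_subset)
  have W11: "u \<in> W11 ?B"
    unfolding W11_def using weak int B by (auto simp: integrable_lebesgue_on_iff)
  \<comment> \<open>equal to \<open>1\<close> on the unit ball and supported where \<open>|x|\<^sup>2 \<le> 2\<close>\<close>
  define \<zeta> where "\<zeta> x = 1 - cutoff 1 x" for x :: "real^'n"
  have \<zeta>: "C1c_gradient ?B2 \<zeta> (\<lambda>x. - cutoff_grad 1 x)"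
  proof -
    have "GDERIV \<zeta> x :> 0 - cutoff_grad 1 x" for x
      unfolding \<zeta>_def[abs_def] using C1_gradient_cutoff[of 1, where 'a='n]
      by (intro GDERIV_diff GDERIV_const) (simp add: C1_gradient_def)
    moreover have "continuous_on UNIV (\<lambda>x. - cutoff_grad 1 x :: real^'n)"
      using C1_gradient_cutoff[of 1, where 'a='n] by (auto simp: C1_gradient_def intro!: continuous_intros)
    moreover have cl: "closure {x. \<zeta> x \<noteq> 0} \<subseteq> cball 0 (sqrt 2)"
    proof (rule closure_minimal)
      show "{x. \<zeta> x \<noteq> 0} \<subseteq> cball 0 (sqrt 2)"
      proof
        fix x assume "x \<in> {x. \<zeta> x \<noteq> 0}"
        then have "x \<bullet> x < 2" using smooth_step_eq_1[of "x \<bullet> x"] by (force simp: \<zeta>_def cutoff_def)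
        then show "x \<in> cball 0 (sqrt 2)" by (simp add: norm_eq_sqrt_inner)
      qed
    qed simp
    moreover have "sqrt 2 < 2" using real_sqrt_less_mono[of 2 4] by simp
    then have "cball 0 (sqrt 2) \<subseteq> ?B2" by auto
    moreover have "compact (closure {x. \<zeta> x \<noteq> 0})"
      using cl by (meson bounded_cball bounded_subset closed_closure compact_eq_bounded_closed)
    ultimately show ?thesis
      unfolding C1c_gradient_def C1_gradient_def by auto
  qed
  define w where "w k x = \<zeta> x * cutoff k x * u x" for k x
  define Dw where "Dw k x = (\<zeta> x * cutoff k x) *\<^sub>R Du x
      + u x *\<^sub>R (\<zeta> x *\<^sub>R cutoff_grad k x + cutoff k x *\<^sub>R - cutoff_grad 1 x)" for k x
  have C1: "C1_gradient (w k) (Dw k)" for k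
  proof -
    have "C1c_gradient (?B2 - {0}) (w k) (Dw k)"
      unfolding w_def Dw_def
      using grad by (intro C1c_gradient_mult C1c_gradient_cutoff_mult[OF \<zeta>]) auto
    then show ?thesis by (simp add: C1c_gradient_def)
  qed
  have near: "\<zeta> x = 1" "cutoff_grad 1 x = 0" if "x \<in> ?B" for x
  proof -
    have "x \<bullet> x \<le> 1" using that by (simp add: dot_square_norm power_le_one)
    then show "\<zeta> x = 1" "cutoff_grad 1 x = 0"
      by (auto simp: \<zeta>_def cutoff_def cutoff_grad_def smooth_step_eq_0 smooth_step'_eq_0)
  qed
  note [measurable] = um Dum C1_gradient_measurable[OF C1] cutoff_measurable
  have AE: "AE x in ?M. x \<noteq> 0 \<and> x \<in> ?B"
    using AE_lebesgue_on_nonzero[OF B] AE_space[of ?M] by eventually_elim auto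
  have lim1: "(\<lambda>k. LINT x|?M. \<bar>w k x - u x\<bar>) \<longlonglongrightarrow> (LINT x|?M. 0)"
  proof (rule integral_dominated_convergence)
    show "(\<lambda>x. \<bar>w k x - u x\<bar>) \<in> borel_measurable ?M" for k
      by (rule borel_measurable_lebesgue_onI) measurable
    show "integrable ?M (\<lambda>x. \<bar>u x\<bar>)" using int(1) by simp
    show "AE x in ?M. (\<lambda>k. \<bar>w k x - u x\<bar>) \<longlonglongrightarrow> 0"
      using AE
    proof eventually_elim
      fix x assume x: "x \<noteq> 0 \<and> x \<in> ?B"
      show "(\<lambda>k. \<bar>w k x - u x\<bar>) \<longlonglongrightarrow> 0"
        by (rule tendsto_eventually, rule eventually_mono[OF eventually_cutoff[of x]])
          (use x near in \<open>auto simp: w_def\<close>)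
    qed
    fix k
    show "AE x in ?M. norm \<bar>w k x - u x\<bar> \<le> \<bar>u x\<bar>"
      using AE
    proof eventually_elim
      fix x assume x: "x \<noteq> 0 \<and> x \<in> ?B"
      have "w k x - u x = (cutoff k x - 1) * u x"
        using near x by (simp add: w_def left_diff_distrib)
      then have "\<bar>w k x - u x\<bar> = \<bar>cutoff k x - 1\<bar> * \<bar>u x\<bar>" by (simp only: abs_mult)
      also have "\<dots> \<le> 1 * \<bar>u x\<bar>" using cutoff_bounds[of k x] by (intro mult_right_mono) auto
      finally show "norm \<bar>w k x - u x\<bar> \<le> \<bar>u x\<bar>" by simp
    qed
  qed simp
  have lim2: "(\<lambda>k. LINT x|?M. norm (Dw k x - Du x)) \<longlonglongrightarrow> (LINT x|?M. 0)"
  proof (rule integral_dominated_convergence)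
    show "(\<lambda>x. norm (Dw k x - Du x)) \<in> borel_measurable ?M" for k
      by (rule borel_measurable_lebesgue_onI) measurable
    show "integrable ?M (\<lambda>x. norm (Du x) + 16 * \<bar>u x / norm x\<bar>)"
      using int(3) integrable_abs[OF int(2)]
      by (intro Bochner_Integration.integrable_add integrable_mult_right) auto
    show "AE x in ?M. (\<lambda>k. norm (Dw k x - Du x)) \<longlonglongrightarrow> 0"
      using AE
    proof eventually_elim
      fix x assume x: "x \<noteq> 0 \<and> x \<in> ?B"
      show "(\<lambda>k. norm (Dw k x - Du x)) \<longlonglongrightarrow> 0"
        by (rule tendsto_eventually, rule eventually_mono[OF eventually_cutoff[of x]])
          (use x near in \<open>auto simp: Dw_def\<close>)
    qed
    fix k
    show "AE x in ?M. norm (norm (Dw k x - Du x)) \<le> norm (Du x) + 16 * \<bar>u x / norm x\<bar>"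
      using AE
    proof eventually_elim
      fix x assume x: "x \<noteq> 0 \<and> x \<in> ?B"
      have "Dw k x - Du x = (cutoff k x - 1) *\<^sub>R Du x + u x *\<^sub>R cutoff_grad k x"
        using near x by (simp add: Dw_def algebra_simps)
      also have "norm \<dots> \<le> \<bar>cutoff k x - 1\<bar> * norm (Du x) + \<bar>u x\<bar> * norm (cutoff_grad k x)"
        by (rule norm_triangle_le) simp
      also have "\<dots> \<le> 1 * norm (Du x) + \<bar>u x\<bar> * (16 / norm x)"
        using cutoff_bounds[of k x] by (intro add_mono mult_mono norm_cutoff_grad_le) auto
      finally show "norm (norm (Dw k x - Du x)) \<le> norm (Du x) + 16 * \<bar>u x / norm x\<bar>"
        by (simp add: abs_divide mult.commute)
    qed
  qed simp
  have lim3: "(LINT x|sphere_measure. \<bar>w k x - 0\<bar>) = 0" for k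
  proof -
    have "space (sphere_measure :: (real^'n) measure) = sphere 0 1"
      unfolding sphere_measure_def by (simp add: space_scale_measure space_restrict_space)
    then have "(LINT x|sphere_measure. \<bar>w k x - 0\<bar>) = (LINT x|(sphere_measure :: (real^'n) measure). 0)"
      using boundary by (intro Bochner_Integration.integral_cong refl) (simp add: w_def)
    then show ?thesis by simp
  qed
  show ?thesis
    unfolding has_trace_def
    using W11 weak int(3) C1 lim1 lim2 lim3 B
    by (intro conjI exI[of _ Du] exI[of _ w] exI[of _ Dw])
      (auto simp: integrable_lebesgue_on_iff[symmetric])
qed

section \<open>The radial profiles\<close>

text \<open>With \<open>\<rho> = r\<^sup>2\<close> this is \<open>1 / (8 - log r)\<close>.  The constant \<open>8\<close> makes it at most \<open>1 / 8\<close> on the unit ball, small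
  enough for the lower-order terms in \<open>inv_log\<close> to be dominated, and keeps it positive on a larger ball.\<close>

definition inv_log :: "real \<Rightarrow> real" where
  "inv_log \<rho> = 1 / (8 - ln \<rho> / 2)"

text \<open>The function \<open>v\<close> with \<open>u = (x \<bullet> e) v\<close>, as a function of \<open>\<rho>\<close>; the subtracted constant is the value of the
  first summand at \<open>\<rho> = 1\<close>.\<close>

definition sol_profile :: "real \<Rightarrow> real \<Rightarrow> real" where
  "sol_profile n \<rho> = \<rho> powr (- n / 2) * (inv_log \<rho> ^ 2 - 2 * inv_log \<rho> ^ 3) - 3 / 256"

definition sol_profile' :: "real \<Rightarrow> real \<Rightarrow> real" where
  "sol_profile' n \<rho> = \<rho> powr (- n / 2) / \<rho> *
     (- n * (inv_log \<rho> ^ 2 - 2 * inv_log \<rho> ^ 3) + 2 * inv_log \<rho> ^ 3 - 6 * inv_log \<rho> ^ 4) / 2"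

text \<open>The function \<open>q\<close> such that the prescribed flux is \<open>v e + (x \<bullet> e) q x\<close>.\<close>

definition flux_profile :: "real \<Rightarrow> real \<Rightarrow> real" where
  "flux_profile n \<rho> = \<rho> powr (- n / 2) / \<rho> * (2 * inv_log \<rho> ^ 3 - n * inv_log \<rho> ^ 2)"

definition flux_profile' :: "real \<Rightarrow> real \<Rightarrow> real" where
  "flux_profile' n \<rho> = \<rho> powr (- n / 2) / \<rho> ^ 2 *
     (- (n + 2) * (2 * inv_log \<rho> ^ 3 - n * inv_log \<rho> ^ 2) + 6 * inv_log \<rho> ^ 4 - 2 * n * inv_log \<rho> ^ 3) / 2"

text \<open>This is \<open>- (v + 2 \<rho> v')\<close>, where \<open>v + 2 \<rho> v'\<close> is the derivative of \<open>r v\<close> with respect to \<open>r\<close>.\<close>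

definition neg_radial_slope :: "real \<Rightarrow> real \<Rightarrow> real" where
  "neg_radial_slope n \<rho> = \<rho> powr (- n / 2) *
     ((n - 1) * (inv_log \<rho> ^ 2 - 2 * inv_log \<rho> ^ 3) - 2 * inv_log \<rho> ^ 3 + 6 * inv_log \<rho> ^ 4) + 3 / 256"

text \<open>The amount by which the coefficient matrix has to exceed the identity in the radial direction in
  order to produce the prescribed flux.\<close>

definition radial_excess :: "real \<Rightarrow> real \<Rightarrow> real" where
  "radial_excess n \<rho> = \<rho> powr (- n / 2) * (2 * n * inv_log \<rho> ^ 3 - 6 * inv_log \<rho> ^ 4) / neg_radial_slope n \<rho>"

lemma inv_log_denom_pos: "0 < \<rho> \<Longrightarrow> \<rho> < 4 \<Longrightarrow> 0 < 8 - ln \<rho> / (2::real)"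
  using ln_le_minus_one[of \<rho>] by linarith

lemma inv_log_bounds:
  assumes "0 < \<rho>" "\<rho> \<le> 1"
  shows "0 < inv_log \<rho>" "inv_log \<rho> \<le> 1 / 8"
proof -
  have "ln \<rho> \<le> 0" using assms by simp
  then show "0 < inv_log \<rho>" "inv_log \<rho> \<le> 1 / 8"
    by (auto simp: inv_log_def field_simps)
qed

lemma DERIV_inv_log:
  assumes "0 < \<rho>" "\<rho> < 4"
  shows "(inv_log has_real_derivative inv_log \<rho> ^ 2 / (2 * \<rho>)) (at \<rho>)"
proof -
  have "((\<lambda>\<rho>. 8 - ln \<rho> / 2) has_real_derivative - (1 / (2 * \<rho>))) (at \<rho>)"
    using assms by (auto intro!: derivative_eq_intros)
  from DERIV_divide[OF DERIV_const[of 1] this] show ?thesis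
    unfolding inv_log_def[abs_def] using inv_log_denom_pos[OF assms]
    by (simp add: power_divide power2_eq_square mult_ac)
qed

lemma DERIV_powr_half:
  assumes "0 < (\<rho>::real)"
  shows "((\<lambda>\<rho>. \<rho> powr (- n / 2)) has_real_derivative - n / 2 * (\<rho> powr (- n / 2) / \<rho>)) (at \<rho>)"
  using assms by (auto intro!: derivative_eq_intros simp: powr_diff)

lemma DERIV_sol_profile:
  assumes "0 < \<rho>" "\<rho> < 4"
  shows "(sol_profile n has_real_derivative sol_profile' n \<rho>) (at \<rho>)"
  unfolding sol_profile_def[abs_def] sol_profile'_def
  by (rule derivative_eq_intros DERIV_inv_log DERIV_powr_half assms refl)+
    (use assms in \<open>simp add: field_simps power2_eq_square power3_eq_cube power4_eq_xxxx\<close>)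

lemma DERIV_flux_profile:
  assumes "0 < \<rho>" "\<rho> < 4"
  shows "(flux_profile n has_real_derivative flux_profile' n \<rho>) (at \<rho>)"
proof -
  have "((\<lambda>\<rho>. \<rho> powr (- n / 2) / \<rho>) has_real_derivative - (n + 2) / 2 * (\<rho> powr (- n / 2) / \<rho> ^ 2)) (at \<rho>)"
    by (rule DERIV_cong[OF DERIV_divide[OF DERIV_powr_half DERIV_ident]])
      (use assms in \<open>simp_all add: field_simps power2_eq_square\<close>)
  moreover have "((\<lambda>\<rho>. 2 * inv_log \<rho> ^ 3 - n * inv_log \<rho> ^ 2) has_real_derivative
      (6 * inv_log \<rho> ^ 4 - 2 * n * inv_log \<rho> ^ 3) / (2 * \<rho>)) (at \<rho>)"
    by (rule derivative_eq_intros DERIV_inv_log assms refl)+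
      (use assms in \<open>simp add: field_simps power2_eq_square power3_eq_cube power4_eq_xxxx\<close>)
  ultimately show ?thesis
    unfolding flux_profile_def[abs_def]
    by (rule DERIV_cong[OF DERIV_mult])
      (use assms in \<open>simp add: flux_profile'_def field_simps power2_eq_square\<close>)
qed

text \<open>Up to the factor \<open>x \<bullet> e\<close>, the left-hand side is the divergence of \<open>v e + (x \<bullet> e) q x\<close>.\<close>

lemma flux_profile_divergence_free:
  "0 < \<rho> \<Longrightarrow> 2 * sol_profile' n \<rho> + (n + 1) * flux_profile n \<rho> + 2 * \<rho> * flux_profile' n \<rho> = 0"
  unfolding sol_profile'_def flux_profile_def flux_profile'_def
  by (simp add: field_simps power2_eq_square power3_eq_cube)

lemma neg_radial_slope_eq: "0 < \<rho> \<Longrightarrow> neg_radial_slope n \<rho> = - (sol_profile n \<rho> + 2 * \<rho> * sol_profile' n \<rho>)"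
  unfolding neg_radial_slope_def sol_profile_def sol_profile'_def by (simp add: field_simps)

text \<open>After division by \<open>y\<^sup>2\<close>, with \<open>y\<close> the value of \<open>inv_log\<close>, the bracket is \<open>(n - 1) (1 - 2 y) - 2 y + 6 y\<^sup>2\<close>;
  for \<open>n \<ge> 2\<close> the first \<open>2 y\<close> is worth at least as much as the second one, and \<open>4 y \<le> 1 / 2\<close>.\<close>

lemma neg_radial_slope_lower:
  assumes "0 < \<rho>" "\<rho> \<le> 1" "2 \<le> n"
  shows "\<rho> powr (- n / 2) * ((n - 1) / 2 * inv_log \<rho> ^ 2) + 3 / 256 \<le> neg_radial_slope n \<rho>"
proof -
  define y where "y = inv_log \<rho>"
  have y: "0 < y" "y \<le> 1 / 8" using inv_log_bounds assms by (auto simp: y_def)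
  have "0 \<le> (n - 2) * y" "(n - 1) * (4 * y) \<le> (n - 1) * (1 / 2)" "0 \<le> y^2"
    using y assms by (auto intro!: mult_left_mono)
  then have "(n - 1) / 2 \<le> (n - 1) * (1 - 2 * y) - 2 * y + 6 * y^2"
    by (simp add: algebra_simps diff_divide_distrib) (use zero_le_power2[of y] in linarith)
  then have "(n - 1) / 2 * y^2 \<le> ((n - 1) * (1 - 2 * y) - 2 * y + 6 * y^2) * y^2"
    by (rule mult_right_mono) simp
  also have "\<dots> = (n - 1) * (y^2 - 2 * y^3) - 2 * y^3 + 6 * y^4"
    by (simp add: algebra_simps power2_eq_square power3_eq_cube power4_eq_xxxx)
  finally show ?thesis
    unfolding neg_radial_slope_def y_def by (intro add_right_mono mult_left_mono) auto
qed

lemma neg_radial_slope_pos: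
  assumes "0 < \<rho>" "\<rho> \<le> 1" "2 \<le> n"
  shows "0 < neg_radial_slope n \<rho>"
proof -
  have "0 \<le> \<rho> powr (- n / 2) * ((n - 1) / 2 * inv_log \<rho> ^ 2)" using assms by simp
  then show ?thesis using neg_radial_slope_lower[OF assms] by linarith
qed

text \<open>The upper bound carries both properties of the coefficient matrix: it is at most \<open>1\<close> since
  \<open>inv_log \<rho> \<le> 1 / 8\<close>, and it tends to \<open>0\<close> at the origin.\<close>

lemma radial_excess_bounds:
  assumes "0 < \<rho>" "\<rho> \<le> 1" "2 \<le> n"
  shows "0 \<le> radial_excess n \<rho>" "radial_excess n \<rho> \<le> 8 * inv_log \<rho>"
proof -
  define y where "y = inv_log \<rho>"
  define s where "s = \<rho> powr (- n / 2)"
  have y: "0 < y" "y \<le> 1 / 8" using inv_log_bounds assms by (auto simp: y_def)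
  have s: "0 < s" using assms by (simp add: s_def)
  note D = neg_radial_slope_pos[OF assms]
  have "6 * y * y^3 \<le> 2 * n * y^3" using y assms by (intro mult_right_mono) auto
  then have "0 \<le> 2 * n * y^3 - 6 * y^4"
    by (simp add: power3_eq_cube power4_eq_xxxx mult_ac)
  then show "0 \<le> radial_excess n \<rho>"
    using s D unfolding radial_excess_def s_def y_def by simp
  have "s * (2 * n * y^3 - 6 * y^4) \<le> s * (4 * (n - 1) * y^3)"
  proof (rule mult_left_mono)
    have "2 * n * y^3 \<le> 4 * (n - 1) * y^3" using y assms by (intro mult_right_mono) auto
    moreover have "0 \<le> y^4" using y by simp
    ultimately show "2 * n * y^3 - 6 * y^4 \<le> 4 * (n - 1) * y^3" by linarith
  qed (use s in simp)
  also have "\<dots> = 8 * y * (s * ((n - 1) / 2 * y^2))"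
    by (simp add: field_simps power2_eq_square power3_eq_cube)
  also have "\<dots> \<le> 8 * y * neg_radial_slope n \<rho>"
    using neg_radial_slope_lower[OF assms] y by (intro mult_left_mono) (auto simp: s_def y_def)
  finally show "radial_excess n \<rho> \<le> 8 * inv_log \<rho>"
    using D unfolding radial_excess_def s_def y_def by (simp add: pos_divide_le_eq)
qed

text \<open>The radial part of \<open>A \<nabla>u = V\<close>.\<close>

lemma flux_profile_eq:
  assumes "0 < \<rho>" "\<rho> \<le> 1" "2 \<le> n"
  shows "2 * sol_profile' n \<rho> + radial_excess n \<rho> / \<rho> * (sol_profile n \<rho> + 2 * \<rho> * sol_profile' n \<rho>) = flux_profile n \<rho>"
proof -
  have "radial_excess n \<rho> * neg_radial_slope n \<rho> = \<rho> powr (- n / 2) * (2 * n * inv_log \<rho> ^ 3 - 6 * inv_log \<rho> ^ 4)"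
    using neg_radial_slope_pos[OF assms] by (simp add: radial_excess_def)
  moreover have "2 * sol_profile' n \<rho> - \<rho> powr (- n / 2) * (2 * n * inv_log \<rho> ^ 3 - 6 * inv_log \<rho> ^ 4) / \<rho> = flux_profile n \<rho>"
    using assms(1) unfolding sol_profile'_def flux_profile_def by (simp add: field_simps)
  moreover have "sol_profile n \<rho> + 2 * \<rho> * sol_profile' n \<rho> = - neg_radial_slope n \<rho>" using neg_radial_slope_eq assms(1) by simp
  ultimately show ?thesis by (simp add: field_simps)
qed

lemma sol_profile_at_1: "sol_profile n 1 = 0"
  by (simp add: sol_profile_def inv_log_def power2_eq_square power3_eq_cube)

text \<open>On the unit ball this is a common majorant of \<open>|u| / |x|\<close>, \<open>|\<nabla>u|\<close> and \<open>|V|\<close>, up to constants; the summand \<open>1\<close> accounts for the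
  constant in \<open>sol_profile\<close>.\<close>

definition singular_weight :: "real \<Rightarrow> real \<Rightarrow> real" where
  "singular_weight n \<rho> = \<rho> powr (- n / 2) * inv_log \<rho> ^ 2 + 1"

lemma singular_weight_ge_1: "1 \<le> singular_weight n \<rho>"
  by (simp add: singular_weight_def)

lemma profiles_le_singular_weight:
  assumes "0 \<le> \<rho>" "\<rho> \<le> 1" "0 \<le> n"
  shows "\<bar>sol_profile n \<rho>\<bar> \<le> singular_weight n \<rho>"
    and "\<rho> * \<bar>2 * sol_profile' n \<rho>\<bar> \<le> (n + 8) * singular_weight n \<rho>"
    and "\<rho> * \<bar>flux_profile n \<rho>\<bar> \<le> (n + 2) * singular_weight n \<rho>"
proof -
  define y where "y = inv_log \<rho>"
  define s where "s = \<rho> powr (- n / 2)"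
  have s: "0 \<le> s" by (simp add: s_def)
  have y: "0 < y" "y \<le> 1 / 8"
    using inv_log_bounds[of \<rho>] assms by (cases "\<rho> = 0"; force simp: y_def inv_log_def)+
  have p: "0 \<le> y^2" "0 \<le> y^3" "0 \<le> y^4" "2 * y^3 \<le> y^2" "y^4 \<le> y^2"
  proof -
    have "2 * y * y^2 \<le> 1 * y^2" using y by (intro mult_right_mono) auto
    then show "2 * y^3 \<le> y^2" by (simp add: power2_eq_square power3_eq_cube mult_ac)
    show "y^4 \<le> y^2" using y by (intro power_decreasing) auto
  qed (use y in auto)
  have "\<bar>y^2 - 2 * y^3\<bar> \<le> y^2" using p by linarith
  then have "\<bar>s * (y^2 - 2 * y^3)\<bar> \<le> s * y^2" using s by (simp add: abs_mult mult_left_mono)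
  then show "\<bar>sol_profile n \<rho>\<bar> \<le> singular_weight n \<rho>"
    unfolding sol_profile_def singular_weight_def y_def s_def by linarith
  have aux: "\<rho> * \<bar>s / \<rho> * c\<bar> \<le> k * singular_weight n \<rho>" if "\<bar>c\<bar> \<le> k * y^2" "0 \<le> k" for c k
  proof -
    have "\<rho> * \<bar>s / \<rho> * c\<bar> \<le> s * \<bar>c\<bar>"
      using assms(1) s by (cases "\<rho> = 0") (auto simp: abs_mult)
    also have "\<dots> \<le> s * (k * y^2)" using that s by (intro mult_left_mono) auto
    also have "\<dots> \<le> k * singular_weight n \<rho>"
      using that(2) by (simp add: singular_weight_def y_def s_def algebra_simps)
    finally show ?thesis .
  qed
  have n1: "\<bar>- n * (y^2 - 2 * y^3)\<bar> \<le> n * y^2"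
    using p assms(3) by (auto simp: abs_mult intro!: mult_left_mono)
  have "\<bar>- n * (y^2 - 2 * y^3) + 2 * y^3 - 6 * y^4\<bar> \<le> (n + 8) * y^2"
    using n1 p unfolding distrib_right by linarith
  from aux[OF this] show "\<rho> * \<bar>2 * sol_profile' n \<rho>\<bar> \<le> (n + 8) * singular_weight n \<rho>"
    using assms(3) by (simp add: sol_profile'_def s_def y_def)
  have "0 \<le> n * y^2" using p assms(3) by simp
  then have "\<bar>2 * y^3 - n * y^2\<bar> \<le> (n + 2) * y^2"
    using p unfolding distrib_right by linarith
  from aux[OF this] show "\<rho> * \<bar>flux_profile n \<rho>\<bar> \<le> (n + 2) * singular_weight n \<rho>"
    using assms(3) by (simp add: flux_profile_def s_def y_def)
qed

section \<open>Integrability of the singularity\<close>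

lemma inv_log_measurable [measurable]: "inv_log \<in> borel_measurable borel"
  unfolding inv_log_def[abs_def] by measurable

text \<open>On a dyadic ball the logarithm grows linearly with the index, with slope \<open>ln 2 \<ge> 1 / 2\<close>.\<close>

lemma inv_log_dyadic:
  fixes x :: "'a::real_inner"
  assumes "x \<noteq> 0" "norm x \<le> (1 / 2) ^ j"
  shows "0 < inv_log (x \<bullet> x)" "inv_log (x \<bullet> x) \<le> 2 / real (Suc j)"
proof -
  have "ln (x \<bullet> x) = 2 * ln (norm x)"
    using assms(1) by (simp add: dot_square_norm ln_realpow)
  moreover have "ln (norm x) \<le> ln ((1 / 2) ^ j)"
    using assms by simp
  moreover have "ln ((1 / 2 :: real) ^ j) = - real j * ln 2"
    by (simp add: ln_realpow ln_div)
  moreover have "real j * (1 / 2) \<le> real j * ln 2"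
    using ln2_ge_two_thirds by (intro mult_left_mono) auto
  ultimately have "real (Suc j) / 2 \<le> 8 - ln (x \<bullet> x) / 2" by simp
  then show "0 < inv_log (x \<bullet> x)" "inv_log (x \<bullet> x) \<le> 2 / real (Suc j)"
    unfolding inv_log_def by (auto simp: field_simps)
qed

lemma dyadic_shell:
  fixes x :: "'a::real_normed_vector"
  assumes "x \<noteq> 0" "norm x < 1"
  obtains j where "norm x < (1 / 2) ^ j" "(1 / 2) ^ Suc j \<le> norm x"
proof -
  let ?P = "\<lambda>j. (1 / 2) ^ j \<le> norm x"
  obtain N where "(1 / 2) ^ N < norm x"
    using real_arch_pow_inv[of "norm x" "1 / 2"] assms by auto
  then have P: "?P (LEAST j. ?P j)" by (intro LeastI[of ?P N]) simp
  moreover from P assms have "(LEAST j. ?P j) \<noteq> 0" by (intro notI) simp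
  then obtain j where j: "(LEAST j. ?P j) = Suc j" by (cases "LEAST j. ?P j") auto
  moreover have "\<not> ?P j" by (rule not_less_Least) (simp add: j)
  ultimately show ?thesis using that[of j] by (simp add: not_le)
qed

text \<open>On the \<open>j\<close>-th dyadic shell the singular part of the weight is at most a constant times
  \<open>2\<^sup>n\<^sup>j / (j + 1)\<^sup>2\<close>, while the volume of the
  surrounding ball is a constant times \<open>2\<^sup>-\<^sup>n\<^sup>j\<close>; so the shells contribute a convergent series
  \<open>\<Sum> 1 / (j + 1)\<^sup>2\<close>.\<close>

lemma integrable_singular_weight:
  "integrable (lebesgue_on (ball 0 1)) (\<lambda>x::real^'n. singular_weight (real CARD('n)) (x \<bullet> x))"
proof -
  let ?n = "CARD('n)" and ?B = "ball 0 1 :: (real^'n) set"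
  let ?g = "\<lambda>x::real^'n. indicat_real ?B x * ((x \<bullet> x) powr (- real ?n / 2) * inv_log (x \<bullet> x) ^ 2)"
  define a where "a j = 2 ^ (Suc j * ?n) * (4 / real (Suc j) ^ 2)" for j
  have a: "0 \<le> a j" for j by (simp add: a_def)
  have term_le: "t j \<le> suminf t" for t :: "nat \<Rightarrow> ennreal" and j
    using sum_le_suminf[of t "{j}"] by simp
  have bound: "ennreal (?g x) \<le> (\<Sum>j. ennreal (a j) * indicator (ball 0 ((1 / 2) ^ j)) x)"
    if x0: "x \<noteq> 0" for x :: "real^'n"
  proof (cases "norm x < 1")
    case True
    obtain j where j: "norm x < (1 / 2) ^ j" "(1 / 2) ^ Suc j \<le> norm x"
      by (rule dyadic_shell[OF x0 True])
    have "(x \<bullet> x) powr (- real ?n / 2) = norm x powr (- real ?n)"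
      using x0 by (simp add: dot_square_norm powr_powr flip: powr_numeral)
    also have "\<dots> = (1 / norm x) ^ ?n"
      using x0 by (simp add: powr_minus powr_realpow divide_inverse power_inverse)
    also have "\<dots> \<le> (2 ^ Suc j) ^ ?n"
    proof (rule power_mono)
      have "1 / norm x \<le> 1 / (1 / 2) ^ Suc j"
        using j(2) x0 by (intro divide_left_mono) auto
      then show "1 / norm x \<le> 2 ^ Suc j" by (simp add: power_divide)
    qed auto
    finally have 1: "(x \<bullet> x) powr (- real ?n / 2) \<le> 2 ^ (Suc j * ?n)" by (simp only: power_mult)
    have "inv_log (x \<bullet> x) ^ 2 \<le> (2 / real (Suc j)) ^ 2"
      using inv_log_dyadic[OF x0, of j] j(1) by (intro power_mono) auto
    then have 2: "inv_log (x \<bullet> x) ^ 2 \<le> 4 / real (Suc j) ^ 2" by (simp add: power_divide)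
    have "?g x = (x \<bullet> x) powr (- real ?n / 2) * inv_log (x \<bullet> x) ^ 2" using True by simp
    also have "\<dots> \<le> a j" unfolding a_def using 1 2 by (intro mult_mono) auto
    finally have "?g x \<le> a j" .
    then have "ennreal (?g x) \<le> ennreal (a j) * indicator (ball 0 ((1 / 2) ^ j)) x"
      using j(1) by (simp add: ennreal_leI)
    also have "\<dots> \<le> (\<Sum>j. ennreal (a j) * indicator (ball 0 ((1 / 2) ^ j)) x)"
      by (rule term_le[of "\<lambda>j. ennreal (a j) * indicator (ball 0 ((1 / 2) ^ j)) x"])
    finally show ?thesis .
  qed simp
  define v where "v = unit_ball_vol (real ?n)"
  have v: "0 \<le> v" by (simp add: v_def)
  have "(\<integral>\<^sup>+x. ennreal (?g x) \<partial>lborel)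
      \<le> (\<integral>\<^sup>+x. (\<Sum>j. ennreal (a j) * indicator (ball 0 ((1 / 2) ^ j) :: (real^'n) set) x) \<partial>lborel)"
    by (intro nn_integral_mono_AE) (rule eventually_mono[OF AE_lborel_singleton[of 0] bound])
  also have "\<dots> = (\<Sum>j. ennreal (a j) * emeasure lborel (ball 0 ((1 / 2) ^ j) :: (real^'n) set))"
    by (subst nn_integral_suminf)
      (auto simp: nn_integral_cmult_indicator intro!: borel_measurable_times_ennreal borel_measurable_indicator)
  also have "\<dots> = (\<Sum>j. ennreal (2 ^ ?n * 4 * v * (1 / real (Suc j) ^ 2)))"
  proof (rule suminf_cong)
    fix j
    have "emeasure lborel (ball 0 ((1 / 2) ^ j) :: (real^'n) set) = ennreal (v * ((1 / 2) ^ j) ^ ?n)"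
      by (simp add: emeasure_ball v_def)
    then have "ennreal (a j) * emeasure lborel (ball 0 ((1 / 2) ^ j) :: (real^'n) set)
       = ennreal (a j * (v * ((1 / 2) ^ j) ^ ?n))"
      using a v by (simp add: ennreal_mult)
    also have "a j * (v * ((1 / 2) ^ j) ^ ?n) = 2 ^ ?n * 4 * v * (1 / real (Suc j) ^ 2)"
      by (simp add: a_def power_add power_mult[symmetric] power_divide mult.commute[of j])
    finally show "ennreal (a j) * emeasure lborel (ball 0 ((1 / 2) ^ j) :: (real^'n) set)
       = ennreal (2 ^ ?n * 4 * v * (1 / real (Suc j) ^ 2))" .
  qed
  also have "\<dots> = ennreal (\<Sum>j. 2 ^ ?n * 4 * v * (1 / real (Suc j) ^ 2))"
  proof (rule suminf_ennreal2)
    have "summable (\<lambda>j. 1 / real (Suc j) ^ 2)"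
      using inverse_power_summable[of 2, where 'a=real] unfolding summable_Suc_iff[of "\<lambda>j. 1 / real j ^ 2"]
      by (simp add: divide_inverse)
    then show "summable (\<lambda>j. 2 ^ ?n * 4 * v * (1 / real (Suc j) ^ 2))" by (rule summable_mult)
  qed (use v in simp)
  also have "\<dots> < \<infinity>" by simp
  finally have fin: "(\<integral>\<^sup>+x. ennreal (?g x) \<partial>lborel) < \<infinity>" .
  have "(\<lambda>\<rho>. \<rho> powr (- real ?n / 2) * inv_log \<rho> ^ 2) \<in> borel_measurable borel" by measurable
  from measurable_compose[OF _ this, of "\<lambda>x::real^'n. x \<bullet> x"]
  have gm: "?g \<in> borel_measurable borel"
    by (intro borel_measurable_times borel_measurable_indicator) auto
  have "integrable lborel ?g"
    using fin gm by (subst integrable_iff_bounded) simp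
  then have "integrable (lebesgue_on ?B) ?g"
    using gm by (subst lebesgue_on_eq_lborel) auto
  moreover have "integrable (lebesgue_on ?B) (indicat_real ?B)"
    by (subst lebesgue_on_eq_lborel) (auto simp: emeasure_ball intro!: borel_measurable_indicator)
  ultimately have "integrable (lebesgue_on ?B) (\<lambda>x. ?g x + indicat_real ?B x)"
    by (rule Bochner_Integration.integrable_add)
  moreover have "singular_weight (real ?n) (x \<bullet> x) = ?g x + indicat_real ?B x"
    if "x \<in> space (lebesgue_on ?B)" for x
    using that by (simp add: singular_weight_def)
  ultimately show ?thesis
    by (subst Bochner_Integration.integrable_cong[OF refl])
qed

section \<open>The solution and its flux\<close>

definition sing_sol :: "real^'n \<Rightarrow> real^'n \<Rightarrow> real" where
  "sing_sol e x = (x \<bullet> e) * sol_profile (real CARD('n)) (x \<bullet> x)"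

definition sing_grad :: "real^'n \<Rightarrow> real^'n \<Rightarrow> real^'n" where
  "sing_grad e x = sol_profile (real CARD('n)) (x \<bullet> x) *\<^sub>R e
     + (x \<bullet> e) *\<^sub>R (2 * sol_profile' (real CARD('n)) (x \<bullet> x)) *\<^sub>R x"

definition sing_flux :: "real^'n \<Rightarrow> real^'n \<Rightarrow> real^'n" where
  "sing_flux e x = sol_profile (real CARD('n)) (x \<bullet> x) *\<^sub>R e
     + ((x \<bullet> e) * flux_profile (real CARD('n)) (x \<bullet> x)) *\<^sub>R x"

text \<open>At the origin the quotient is \<open>0 / 0 = 0\<close>, so that the matrix is the identity there, which is the value
  required by continuity.\<close>

definition coefficient :: "real^'n \<Rightarrow> real^'n^'n" where
  "coefficient x = (\<chi> i j. (if i = j then 1 else 0)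
     + radial_excess (real CARD('n)) (x \<bullet> x) * (x $ i * x $ j / (x \<bullet> x)))"

lemma profiles_measurable [measurable]:
  "sol_profile n \<in> borel_measurable borel" "sol_profile' n \<in> borel_measurable borel"
  "flux_profile n \<in> borel_measurable borel"
  unfolding sol_profile_def[abs_def] sol_profile'_def[abs_def] flux_profile_def[abs_def] by measurable

lemma sing_sol_measurable:
  "sing_sol e \<in> borel_measurable borel" "sing_grad e \<in> borel_measurable borel" "sing_flux e \<in> borel_measurable borel"
  unfolding sing_sol_def[abs_def] sing_grad_def[abs_def] sing_flux_def[abs_def] by measurable

text \<open>The profiles are smooth for \<open>0 < \<rho> < 4\<close>.  The ball of radius \<open>2\<close> leaves room beyond the unit sphere,
  which the functions approximating the solution have to cross smoothly.\<close>

lemma inner_self_lt_4: "x \<in> ball 0 2 - {0} \<Longrightarrow> 0 < x \<bullet> x \<and> x \<bullet> x < (4::real)"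
  using power_strict_mono[of "norm x" 2 2] by (auto simp: dot_square_norm)

lemma GDERIV_inner_const: "GDERIV (\<lambda>x. x \<bullet> e) x :> e"
  unfolding gderiv_def by (auto intro!: derivative_eq_intros)

lemma GDERIV_sing_sol:
  assumes "x \<in> ball 0 2 - {0}"
  shows "GDERIV (sing_sol e) x :> sing_grad e x"
  unfolding sing_sol_def[abs_def] sing_grad_def
  using inner_self_lt_4[OF assms]
    GDERIV_mult[OF GDERIV_inner_const GDERIV_radial[OF DERIV_sol_profile], of x e]
  by (simp add: add.commute)

lemma continuous_on_inv_log: "continuous_on {0<..<4} inv_log"
  using DERIV_inv_log by (meson DERIV_isCont continuous_at_imp_continuous_on greaterThanLessThan_iff)

lemma continuous_on_profiles:
  "continuous_on {0<..<4} (sol_profile' n)" "continuous_on {0<..<4} (sol_profile n)" 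
  "continuous_on {0<..<4} (flux_profile n)" "continuous_on {0<..<4} (flux_profile' n)" "continuous_on {0<..<4} (neg_radial_slope n)"
  unfolding sol_profile'_def[abs_def] sol_profile_def[abs_def] flux_profile_def[abs_def] flux_profile'_def[abs_def] neg_radial_slope_def[abs_def]
  by (intro continuous_intros continuous_on_inv_log; auto)+

lemma continuous_on_radial:
  assumes "continuous_on {0<..<4} f"
  shows "continuous_on (ball 0 2 - {0}) (\<lambda>x::'a::real_inner. f (x \<bullet> x))"
proof (rule continuous_on_compose2[OF assms])
  show "(\<lambda>x::'a. x \<bullet> x) ` (ball 0 2 - {0}) \<subseteq> {0<..<4}"
    by (rule image_subsetI) (simp only: greaterThanLessThan_iff inner_self_lt_4)
qed (intro continuous_intros)

lemma continuous_on_sing_grad: "continuous_on (ball 0 2 - {0}) (sing_grad e)"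
  unfolding sing_grad_def[abs_def]
  by (intro continuous_intros continuous_on_radial continuous_on_profiles)

lemma sing_sol_bounds:
  fixes e x :: "real^'n"
  assumes "norm x \<le> 1" "norm e = 1"
  defines "n \<equiv> real CARD('n)" and "W \<equiv> singular_weight (real CARD('n)) (x \<bullet> x)"
  shows "\<bar>sing_sol e x\<bar> \<le> W" "\<bar>sing_sol e x / norm x\<bar> \<le> W"
    "norm (sing_grad e x) \<le> (n + 9) * W" "norm (sing_flux e x) \<le> (n + 3) * W"
proof -
  let ?\<rho> = "x \<bullet> x"
  have \<rho>: "0 \<le> ?\<rho>" "?\<rho> \<le> 1" "0 \<le> n" using assms(1) by (auto simp: dot_square_norm power_le_one n_def)
  note b = profiles_le_singular_weight[OF \<rho>, folded W_def[folded n_def]]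
  have xe: "\<bar>x \<bullet> e\<bar> \<le> norm x" using Cauchy_Schwarz_ineq2[of x e] assms(2) by simp
  have W: "0 \<le> W" using singular_weight_ge_1[of n ?\<rho>] by (simp add: W_def n_def)
  have "\<bar>sing_sol e x\<bar> \<le> norm x * W"
    unfolding sing_sol_def abs_mult n_def[symmetric] using xe b(1) by (intro mult_mono) (auto simp: W_def n_def)
  then show "\<bar>sing_sol e x / norm x\<bar> \<le> W"
    using W by (cases "x = 0") (auto simp: abs_divide field_simps)
  have "norm x * W \<le> 1 * W" using assms(1) W by (intro mult_right_mono)
  then show "\<bar>sing_sol e x\<bar> \<le> W" using \<open>\<bar>sing_sol e x\<bar> \<le> norm x * W\<close> by simp
  have aux: "norm (((x \<bullet> e) * c) *\<^sub>R x) \<le> ?\<rho> * \<bar>c\<bar>" for c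
  proof -
    have "norm (((x \<bullet> e) * c) *\<^sub>R x) = \<bar>x \<bullet> e\<bar> * (\<bar>c\<bar> * norm x)" by (simp add: abs_mult)
    also have "\<dots> \<le> norm x * (\<bar>c\<bar> * norm x)" using xe by (intro mult_right_mono) auto
    finally show ?thesis by (simp add: dot_square_norm power2_eq_square mult_ac)
  qed
  have p: "norm (sol_profile n ?\<rho> *\<^sub>R e) \<le> W" using b(1) assms(2) by (simp add: W_def n_def)
  have "norm (sing_grad e x) \<le> norm (sol_profile n ?\<rho> *\<^sub>R e) + norm (((x \<bullet> e) * (2 * sol_profile' n ?\<rho>)) *\<^sub>R x)"
    unfolding sing_grad_def n_def scaleR_scaleR by (rule norm_triangle_ineq)
  also have "\<dots> \<le> W + (n + 8) * W"
    using p aux[of "2 * sol_profile' n ?\<rho>"] b(2) unfolding W_def n_def by linarith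
  finally show "norm (sing_grad e x) \<le> (n + 9) * W" by (simp add: algebra_simps)
  have "norm (sing_flux e x) \<le> norm (sol_profile n ?\<rho> *\<^sub>R e) + norm (((x \<bullet> e) * flux_profile n ?\<rho>) *\<^sub>R x)"
    unfolding sing_flux_def n_def by (rule norm_triangle_ineq)
  also have "\<dots> \<le> W + (n + 2) * W"
    using p aux[of "flux_profile n ?\<rho>"] b(3) unfolding W_def n_def by linarith
  finally show "norm (sing_flux e x) \<le> (n + 3) * W" by (simp add: algebra_simps)
qed

lemma integrable_sing_sol:
  fixes e :: "real^'n"
  assumes "norm e = 1"
  shows "integrable (lebesgue_on (ball 0 1)) (sing_sol e)"
    "integrable (lebesgue_on (ball 0 1)) (\<lambda>x. sing_sol e x / norm x)"
    "integrable (lebesgue_on (ball 0 1)) (sing_grad e)"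
    "integrable (lebesgue_on (ball 0 1)) (sing_flux e)"
proof -
  let ?M = "lebesgue_on (ball 0 1 :: (real^'n) set)"
  have dom: "integrable ?M f"
    if fm: "f \<in> borel_measurable borel"
      and le: "\<And>x. norm x \<le> 1 \<Longrightarrow> norm (f x) \<le> c * singular_weight (real CARD('n)) (x \<bullet> x)"
    for f :: "real^'n \<Rightarrow> 'b::euclidean_space" and c
  proof (rule Bochner_Integration.integrable_bound)
    show "integrable ?M (\<lambda>x. c * singular_weight (real CARD('n)) (x \<bullet> x))"
      using integrable_singular_weight by (rule integrable_mult_right)
    show "f \<in> borel_measurable ?M" using fm by (rule borel_measurable_lebesgue_onI)
    show "AE x in ?M. norm (f x) \<le> norm (c * singular_weight (real CARD('n)) (x \<bullet> x))"
    proof (rule AE_I2)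
      fix x assume "x \<in> space ?M"
      then have "norm (f x) \<le> c * singular_weight (real CARD('n)) (x \<bullet> x)" by (intro le) simp
      then show "norm (f x) \<le> norm (c * singular_weight (real CARD('n)) (x \<bullet> x))"
        unfolding real_norm_def by linarith
    qed
  qed
  note [measurable] = sing_sol_measurable
  show "integrable ?M (sing_sol e)" 
    using sing_sol_bounds(1)[OF _ assms] by (intro dom[of _ 1] sing_sol_measurable) simp
  show "integrable ?M (\<lambda>x. sing_sol e x / norm x)" 
    using sing_sol_bounds(2)[OF _ assms] by (intro dom[of _ 1]) simp_all
  show "integrable ?M (sing_grad e)" 
    using sing_sol_bounds(3)[OF _ assms] by (intro dom sing_sol_measurable)
  show "integrable ?M (sing_flux e)" 
    using sing_sol_bounds(4)[OF _ assms] by (intro dom sing_sol_measurable)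
qed

text \<open>Split the flux into \<open>P e\<close> and \<open>Q x\<close>, with scalar functions \<open>P\<close> and \<open>Q\<close>.  Multiplied by the test function,
  the first field is differentiated along \<open>e\<close> only and the second one is covered by
  \<open>integral_C1c_euler\<close>; the terms without derivatives of \<open>\<psi>\<close> cancel by
  \<open>flux_profile_divergence_free\<close>.\<close>

lemma sing_flux_divergence_free:
  fixes e :: "real^'n"
  assumes \<psi>: "C1c_gradient (ball 0 1 - {0}) \<psi> D\<psi>"
  shows "(LINT x|lebesgue_on (ball 0 1). sing_flux e x \<bullet> D\<psi> x) = 0"
proof -
  let ?n = "real CARD('n)"
  have sub: "ball 0 1 - {0} \<subseteq> (ball 0 2 - {0} :: (real^'n) set)" by auto
  have lt4: "0 < x \<bullet> x" "x \<bullet> x < 4" if "x \<in> ball 0 1 - {0}" for x :: "real^'n"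
    using inner_self_lt_4[of x] that sub by auto
  have op: "open (ball 0 1 - {0} :: (real^'n) set)" by auto
  define DP where "DP x = (2 * sol_profile' ?n (x \<bullet> x)) *\<^sub>R x" for x :: "real^'n"
  define D1 where "D1 x = \<psi> x *\<^sub>R DP x + sol_profile ?n (x \<bullet> x) *\<^sub>R D\<psi> x" for x
  have D1: "C1c_gradient (ball 0 1 - {0}) (\<lambda>x. \<psi> x * sol_profile ?n (x \<bullet> x)) D1"
    unfolding D1_def
  proof (rule C1c_gradient_mult[OF \<psi> op])
    show "GDERIV (\<lambda>x. sol_profile ?n (x \<bullet> x)) x :> DP x" if "x \<in> ball 0 1 - {0}" for x :: "real^'n"
      unfolding DP_def by (intro GDERIV_radial DERIV_sol_profile lt4 that)
    have "continuous_on (ball 0 2 - {0}) DP"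
      unfolding DP_def by (intro continuous_intros continuous_on_radial continuous_on_profiles)
    then show "continuous_on (ball 0 1 - {0}) DP" using sub by (rule continuous_on_subset)
  qed
  define DQ where "DQ x = flux_profile ?n (x \<bullet> x) *\<^sub>R e + ((x \<bullet> e) * (2 * flux_profile' ?n (x \<bullet> x))) *\<^sub>R x" for x
  define D2 where "D2 x = \<psi> x *\<^sub>R DQ x + ((x \<bullet> e) * flux_profile ?n (x \<bullet> x)) *\<^sub>R D\<psi> x" for x
  have D2: "C1c_gradient (ball 0 1 - {0}) (\<lambda>x. \<psi> x * ((x \<bullet> e) * flux_profile ?n (x \<bullet> x))) D2"
    unfolding D2_def
  proof (rule C1c_gradient_mult[OF \<psi> op])
    show "GDERIV (\<lambda>x. (x \<bullet> e) * flux_profile ?n (x \<bullet> x)) x :> DQ x" if "x \<in> ball 0 1 - {0}" for x :: "real^'n"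
      using GDERIV_mult[OF GDERIV_inner_const GDERIV_radial[OF DERIV_flux_profile[OF lt4[OF that]]], of e ?n]
      by (simp add: DQ_def add.commute)
    have "continuous_on (ball 0 2 - {0}) DQ"
      unfolding DQ_def by (intro continuous_intros continuous_on_radial continuous_on_profiles)
    then show "continuous_on (ball 0 1 - {0}) DQ" using sub by (rule continuous_on_subset)
  qed
  let ?E = "\<lambda>x. ?n * (\<psi> x * ((x \<bullet> e) * flux_profile ?n (x \<bullet> x))) + x \<bullet> D2 x"
  have eq: "sing_flux e x \<bullet> D\<psi> x = D1 x \<bullet> e + ?E x" for x
  proof (cases "x \<in> ball 0 1 - {0}")
    case True
    have "D1 x \<bullet> e = \<psi> x * (2 * sol_profile' ?n (x \<bullet> x) * (x \<bullet> e)) + sol_profile ?n (x \<bullet> x) * (e \<bullet> D\<psi> x)"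
      by (simp add: D1_def DP_def inner_add_left inner_commute[of "D\<psi> x" e])
    moreover have "x \<bullet> D2 x = \<psi> x * (flux_profile ?n (x \<bullet> x) * (x \<bullet> e) + (x \<bullet> e) * (2 * flux_profile' ?n (x \<bullet> x)) * (x \<bullet> x))
        + (x \<bullet> e) * flux_profile ?n (x \<bullet> x) * (x \<bullet> D\<psi> x)"
      by (simp add: D2_def DQ_def inner_add_right)
    moreover have "sing_flux e x \<bullet> D\<psi> x
        = sol_profile ?n (x \<bullet> x) * (e \<bullet> D\<psi> x) + (x \<bullet> e) * flux_profile ?n (x \<bullet> x) * (x \<bullet> D\<psi> x)"
      by (simp add: sing_flux_def inner_add_left)
    ultimately have "D1 x \<bullet> e + ?E x - sing_flux e x \<bullet> D\<psi> x = \<psi> x * (x \<bullet> e) *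
       (2 * sol_profile' ?n (x \<bullet> x) + (?n + 1) * flux_profile ?n (x \<bullet> x) + 2 * (x \<bullet> x) * flux_profile' ?n (x \<bullet> x))"
      by (simp only:) (simp add: algebra_simps)
    then show ?thesis using flux_profile_divergence_free[OF lt4(1)[OF True], of ?n] by simp
  next
    case False
    then show ?thesis
      using C1c_gradient_zero[OF \<psi>, of x] by (simp add: D1_def D2_def)
  qed
  note [measurable] = sing_sol_measurable
  have [measurable]: "D\<psi> \<in> borel_measurable borel"
    using \<psi> C1_gradient_measurable by (auto simp: C1c_gradient_def)
  have "(LINT x|lebesgue_on (ball 0 1). sing_flux e x \<bullet> D\<psi> x) = (LINT x|lborel. sing_flux e x \<bullet> D\<psi> x)"
    by (rule lebesgue_on_eq_lborel) (use C1c_gradient_zero(2)[OF \<psi>] in auto)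
  also have "\<dots> = (LINT x|lborel. D1 x \<bullet> e) + (LINT x|lborel. ?E x)"
    unfolding eq using integral_C1c_gradient(1)[OF D1] integral_C1c_euler(1)[OF D2 op]
    by (intro Bochner_Integration.integral_add integrable_inner_left) auto
  also have "\<dots> = 0"
    using integral_C1c_gradient[OF D1] integral_C1c_euler(2)[OF D2 op]
    by (simp add: integral_inner_left)
  finally show ?thesis .
qed

lemma coefficient_mult:
  fixes x \<xi> :: "real^'n"
  shows "coefficient x *v \<xi> = \<xi> + (radial_excess (real CARD('n)) (x \<bullet> x) / (x \<bullet> x) * (x \<bullet> \<xi>)) *\<^sub>R x"
proof (rule vec_eq_iff[THEN iffD2], rule allI)
  fix i
  define c where "c = radial_excess (real CARD('n)) (x \<bullet> x) / (x \<bullet> x)"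
  have "(coefficient x *v \<xi>) $ i = (\<Sum>j\<in>UNIV. (if i = j then \<xi> $ j else 0) + c * x $ i * (x $ j * \<xi> $ j))"
    unfolding matrix_vector_mult_def coefficient_def c_def
    by (auto intro!: sum.cong simp: algebra_simps)
  also have "\<dots> = \<xi> $ i + c * x $ i * (x \<bullet> \<xi>)"
    by (simp add: sum.distrib sum_distrib_left inner_vec_def)
  finally show "(coefficient x *v \<xi>) $ i = (\<xi> + (c * (x \<bullet> \<xi>)) *\<^sub>R x) $ i" by simp
qed

lemma coefficient_mult_grad:
  fixes x :: "real^'n"
  assumes "2 \<le> CARD('n)" "norm x \<le> 1"
  shows "coefficient x *v sing_grad e x = sing_flux e x"
proof (cases "x = 0")
  case True
  then show ?thesis by (simp add: coefficient_mult sing_grad_def sing_flux_def)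
next
  case False
  let ?n = "real CARD('n)" and ?\<rho> = "x \<bullet> x"
  have \<rho>: "0 < ?\<rho>" "?\<rho> \<le> 1" using False assms(2) by (auto simp: dot_square_norm power_le_one)
  have "x \<bullet> sing_grad e x = (x \<bullet> e) * (sol_profile ?n ?\<rho> + 2 * ?\<rho> * sol_profile' ?n ?\<rho>)"
    by (simp add: sing_grad_def inner_add_right algebra_simps)
  then have "coefficient x *v sing_grad e x = sol_profile ?n ?\<rho> *\<^sub>R e + ((x \<bullet> e) *
      (2 * sol_profile' ?n ?\<rho> + radial_excess ?n ?\<rho> / ?\<rho> * (sol_profile ?n ?\<rho> + 2 * ?\<rho> * sol_profile' ?n ?\<rho>))) *\<^sub>R x"
    unfolding coefficient_mult by (simp add: sing_grad_def distrib_left scaleR_add_left mult_ac)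
  also have "\<dots> = sing_flux e x"
    using flux_profile_eq[of ?\<rho> ?n] \<rho> assms(1) by (simp add: sing_flux_def)
  finally show ?thesis .
qed

lemma inv_log_tendsto_0: "((\<lambda>x::'a::euclidean_space. inv_log (x \<bullet> x)) \<longlongrightarrow> 0) (at 0)"
proof -
  have "filterlim (\<lambda>\<rho>::real. - ln \<rho>) at_top (at_right 0)"
    using ln_at_0 by (simp add: filterlim_uminus_at_top)
  then have "filterlim (\<lambda>\<rho>::real. 8 + 1 / 2 * (- ln \<rho>)) at_top (at_right 0)"
    by (intro filterlim_tendsto_add_at_top[OF tendsto_const]
        filterlim_tendsto_pos_mult_at_top[OF tendsto_const]) auto
  then have "filterlim (\<lambda>\<rho>::real. 8 - ln \<rho> / 2) at_top (at_right 0)" by simp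
  then have "(inv_log \<longlongrightarrow> 0) (at_right 0)"
    unfolding inv_log_def[abs_def]
    by (intro tendsto_divide_0[OF tendsto_const] filterlim_at_top_imp_at_infinity) simp
  moreover have "filterlim (\<lambda>x::'a. x \<bullet> x) (at_right 0) (at 0)"
    unfolding filterlim_at
    by (auto simp: eventually_at_filter intro!: tendsto_eq_intros)
  ultimately show ?thesis by (rule filterlim_compose)
qed

lemma radial_excess_bounds_ball:
  fixes x :: "real^'n"
  assumes "2 \<le> CARD('n)" "norm x \<le> 1" "x \<noteq> 0"
  shows "0 \<le> radial_excess (real CARD('n)) (x \<bullet> x)" "radial_excess (real CARD('n)) (x \<bullet> x) \<le> 8 * inv_log (x \<bullet> x)"
    "radial_excess (real CARD('n)) (x \<bullet> x) \<le> 1"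
proof -
  have \<rho>: "0 < x \<bullet> x" "x \<bullet> x \<le> 1" using assms(2,3) by (auto simp: dot_square_norm power_le_one)
  show "0 \<le> radial_excess (real CARD('n)) (x \<bullet> x)" 
    and *: "radial_excess (real CARD('n)) (x \<bullet> x) \<le> 8 * inv_log (x \<bullet> x)"
    using radial_excess_bounds[OF \<rho>, of "real CARD('n)"] assms(1) by auto
  show "radial_excess (real CARD('n)) (x \<bullet> x) \<le> 1" using * inv_log_bounds(2)[OF \<rho>] by linarith
qed

text \<open>Away from the origin every entry is a composition of continuous functions.  At the origin the entries
  of \<open>x x\<^sup>T / |x|\<^sup>2\<close> have no limit, but they are bounded by \<open>1\<close> and come with a factor that tends to \<open>0\<close>.\<close>

lemma continuous_on_coefficient:
  assumes "2 \<le> CARD('n)"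
  shows "continuous_on (cball 0 1) (coefficient :: real^'n \<Rightarrow> real^'n^'n)"
proof -
  let ?n = "real CARD('n)" and ?C = "cball 0 1 :: (real^'n) set"
  define f where "f i j x = radial_excess ?n (x \<bullet> x) * (x $ i * x $ j / (x \<bullet> x))" for i j and x :: "real^'n"
  have "continuous_on ?C (f i j)" for i j
    unfolding continuous_on_def
  proof
    fix x assume x: "x \<in> ?C"
    show "(f i j \<longlongrightarrow> f i j x) (at x within ?C)"
    proof (cases "x = 0")
      case True
      have "(f i j \<longlongrightarrow> 0) (at 0 within ?C)"
      proof (rule Lim_null_comparison)
        show "((\<lambda>x::real^'n. 8 * inv_log (x \<bullet> x)) \<longlongrightarrow> 0) (at 0 within ?C)"
          using tendsto_mult_left[OF tendsto_within_subset[OF inv_log_tendsto_0 subset_UNIV], of 8 ?C] by simp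
        have "norm (f i j z) \<le> 8 * inv_log (z \<bullet> z)" if "z \<noteq> 0" "z \<in> ?C" for z
        proof -
          have "\<bar>z $ i\<bar> * \<bar>z $ j\<bar> \<le> norm z * norm z"
            by (intro mult_mono component_le_norm_cart) auto
          then have "\<bar>z $ i * z $ j / (z \<bullet> z)\<bar> \<le> 1"
            using that by (simp add: abs_mult abs_divide dot_square_norm power2_eq_square)
          then have "\<bar>f i j z\<bar> \<le> radial_excess ?n (z \<bullet> z) * 1"
            unfolding f_def abs_mult using radial_excess_bounds_ball[OF assms, of z] that by (intro mult_mono) auto
          then show ?thesis using radial_excess_bounds_ball(2)[OF assms, of z] that by simp
        qed
        then show "\<forall>\<^sub>F z in at 0 within ?C. norm (f i j z) \<le> 8 * inv_log (z \<bullet> z)"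
          by (auto simp: eventually_at_filter)
      qed
      then show ?thesis using True by (simp add: f_def)
    next
      case False
      have "neg_radial_slope ?n (x \<bullet> x) \<noteq> 0" if "x \<in> ?C - {0}" for x :: "real^'n"
        using neg_radial_slope_pos[of "x \<bullet> x" ?n] that assms by (auto simp: dot_square_norm power_le_one)
      moreover have radial: "continuous_on (?C - {0}) (\<lambda>x. g (x \<bullet> x))"
        if "continuous_on {0<..<4} g" for g :: "real \<Rightarrow> real"
        by (rule continuous_on_subset[OF continuous_on_radial[OF that]]) auto
      ultimately have "continuous_on (?C - {0}) (f i j)"
        unfolding f_def radial_excess_def
        by (intro continuous_intros radial[OF continuous_on_inv_log] radial[OF continuous_on_profiles(5)]) auto
      then have "(f i j \<longlongrightarrow> f i j x) (at x within ?C - {0})"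
        using x False by (simp add: continuous_on_def)
      moreover have "at x within ?C - {0} = at x within ?C"
        using False by (intro at_within_nhd[of x "- {0}"]) auto
      ultimately show ?thesis by simp
    qed
  qed
  then show ?thesis
    unfolding coefficient_def f_def by (intro continuous_on_vec_lambda continuous_on_add continuous_on_const) auto
qed

lemma elliptic_coefficient:
  assumes "2 \<le> CARD('n)"
  shows "elliptic (ball 0 1) (coefficient :: real^'n \<Rightarrow> real^'n^'n)"
  unfolding elliptic_def
proof (intro conjI)
  note cont = continuous_on_coefficient[OF assms]
  show "coefficient \<in> borel_measurable (lebesgue_on (ball 0 1 :: (real^'n) set))"
    by (intro continuous_imp_measurable_on_sets_lebesgue continuous_on_subset[OF cont]) auto
  have "bounded (coefficient ` (cball 0 1 :: (real^'n) set))"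
    by (intro compact_imp_bounded compact_continuous_image cont) auto
  then show "bounded (coefficient ` (ball 0 1 :: (real^'n) set))"
    by (rule bounded_subset) auto
  show "\<forall>x\<in>ball 0 1. transpose (coefficient x) = (coefficient x :: real^'n^'n)"
    by (auto simp: vec_eq_iff transpose_def coefficient_def mult.commute)
  have "1 * (norm \<xi>)\<^sup>2 \<le> (coefficient x *v \<xi>) \<bullet> \<xi> \<and> (coefficient x *v \<xi>) \<bullet> \<xi> \<le> 2 * (norm \<xi>)\<^sup>2"
    if x: "x \<in> ball 0 1" for x \<xi> :: "real^'n"
  proof (cases "x = 0")
    case True
    then show ?thesis by (simp add: coefficient_mult dot_square_norm)
  next
    case False
    define q where "q = (x \<bullet> \<xi>)\<^sup>2 / (x \<bullet> x)"
    have "(x \<bullet> \<xi>)\<^sup>2 \<le> (x \<bullet> x) * (\<xi> \<bullet> \<xi>)" by (rule Cauchy_Schwarz_ineq)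
    then have q: "0 \<le> q" "q \<le> (norm \<xi>)\<^sup>2" 
      using False by (auto simp: q_def dot_square_norm field_simps)
    have eq: "(coefficient x *v \<xi>) \<bullet> \<xi> = (norm \<xi>)\<^sup>2 + radial_excess (real CARD('n)) (x \<bullet> x) * q"
      by (simp add: coefficient_mult inner_add_left q_def power2_norm_eq_inner) (simp add: power2_eq_square)
    have e: "0 \<le> radial_excess (real CARD('n)) (x \<bullet> x)" "radial_excess (real CARD('n)) (x \<bullet> x) \<le> 1"
      using radial_excess_bounds_ball[OF assms _ False] x by auto
    have "radial_excess (real CARD('n)) (x \<bullet> x) * q \<le> 1 * (norm \<xi>)\<^sup>2" using e q by (intro mult_mono) auto
    moreover have "0 \<le> radial_excess (real CARD('n)) (x \<bullet> x) * q" using e q by simp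
    ultimately show ?thesis unfolding eq by linarith
  qed
  then show "\<exists>l L. l > 0 \<and> L > 0 \<and> (\<forall>x\<in>ball 0 1. \<forall>\<xi>::real^'n. l * (norm \<xi>)\<^sup>2 \<le> (coefficient x *v \<xi>) \<bullet> \<xi>
      \<and> (coefficient x *v \<xi>) \<bullet> \<xi> \<le> L * (norm \<xi>)\<^sup>2)"
    by (intro exI[of _ 1] exI[of _ 2]) auto
qed

lemma sing_sol_not_AE_zero:
  fixes e :: "real^'n"
  assumes e: "norm e = 1"
  shows "\<not> (AE x in lebesgue_on (ball 0 1). sing_sol e x = 0)"
proof
  assume ae: "AE x in lebesgue_on (ball 0 1). sing_sol e x = 0"
  define S where "S = (ball 0 1 - {0}) \<inter> sing_sol e -` (- {0})"
  have "continuous_on (ball 0 1 - {0}) (sing_sol e)"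
  proof (rule continuous_at_imp_continuous_on, rule ballI)
    fix x :: "real^'n" assume "x \<in> ball 0 1 - {0}"
    then have "GDERIV (sing_sol e) x :> sing_grad e x" by (intro GDERIV_sing_sol) auto
    then show "isCont (sing_sol e) x" unfolding gderiv_def by (rule has_derivative_continuous)
  qed
  then have "open S"
    unfolding S_def by (intro continuous_open_preimage) auto
  \<comment> \<open>here \<open>inv_log\<close> takes the simple value \<open>1 / 16\<close> and \<open>\<rho> powr (- n / 2)\<close> is already large\<close>
  moreover have "exp (- 8) *\<^sub>R e \<in> S"
  proof -
    let ?n = "real CARD('n)" and ?x = "exp (- 8) *\<^sub>R e"
    have \<rho>: "?x \<bullet> ?x = exp (- 16)"
      using e by (simp add: dot_square_norm power_mult_distrib flip: exp_of_nat_mult)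
    have "9 \<le> 1 + 8 * ?n" by simp
    also have "\<dots> \<le> exp (8 * ?n)" by (rule exp_ge_add_one_self)
    finally have "9 \<le> exp (8 * ?n)" .
    moreover have "sol_profile ?n (exp (- 16)) = exp (8 * ?n) * (7 / 2048) - 3 / 256"
      by (simp add: sol_profile_def inv_log_def powr_def power2_eq_square power3_eq_cube)
    ultimately have "0 < sol_profile ?n (?x \<bullet> ?x)" unfolding \<rho> by simp
    moreover have "?x \<bullet> e = exp (- 8)" using e by (simp add: dot_square_norm)
    ultimately have "sing_sol e ?x \<noteq> 0" unfolding sing_sol_def by simp
    then show ?thesis using e by (auto simp: S_def)
  qed
  moreover have "negligible S"
  proof -
    have "AE x in lebesgue. x \<in> ball 0 1 \<longrightarrow> sing_sol e x = 0"
      using ae by (simp add: AE_restrict_space_iff)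
    then have "AE x in lebesgue. x \<notin> S" by eventually_elim (auto simp: S_def)
    then show ?thesis
      using \<open>open S\<close> by (simp add: negligible_iff_null_sets AE_iff_null_sets)
  qed
  ultimately show False using open_not_negligible by blast
qed

theorem proposition1p3:
  assumes "CARD('n::finite) \<ge> 2"
  shows "\<exists>A :: real^'n \<Rightarrow> real^'n^'n.
           continuous_on (ball 0 1) A \<and> elliptic (ball 0 1) A \<and>
           (\<exists>u. u \<in> W11 (ball 0 1) \<and>
                \<not> (AE x in lebesgue_on (ball 0 1). u x = 0) \<and>
                weak_solution (ball 0 1) A u \<and>
                has_trace u (\<lambda>x. 0))"
proof -
  \<comment> \<open>any unit vector will do\<close>
  define e where "e = (axis undefined 1 :: real^'n)"
  have e: "norm e = 1" by (simp add: e_def norm_axis_1)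
  note int = integrable_sing_sol[OF e]
  have "x \<bullet> x = 1" if "norm x = 1" for x :: "real^'n" using that by (simp add: dot_square_norm)
  then have trace: "has_trace (sing_sol e) (\<lambda>x. 0)"
    by (intro has_trace_zero_puncture[OF sing_sol_measurable(1,2) GDERIV_sing_sol continuous_on_sing_grad int(1-3)])
      (auto simp: sing_sol_def sol_profile_at_1)
  then have W11: "sing_sol e \<in> W11 (ball 0 1)" by (simp add: has_trace_def)
  have weak: "weak_gradient (ball 0 1) (sing_sol e) (sing_grad e)"
    by (rule weak_gradient_puncture[OF _ sing_sol_measurable(1,2) GDERIV_sing_sol _ int(1-3)])
      (auto intro: continuous_on_subset[OF continuous_on_sing_grad])
  have "(LINT x|lebesgue_on (ball 0 1). (coefficient x *v sing_grad e x) \<bullet> D\<phi> x) = 0"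
    if \<phi>: "C1c_gradient (ball 0 1) \<phi> D\<phi>" for \<phi> D\<phi>
  proof -
    have "(LINT x|lebesgue_on (ball 0 1). (coefficient x *v sing_grad e x) \<bullet> D\<phi> x)
        = (LINT x|lebesgue_on (ball 0 1). sing_flux e x \<bullet> D\<phi> x)"
      using assms by (intro Bochner_Integration.integral_cong refl) (simp add: coefficient_mult_grad)
    also have "\<dots> = 0"
      by (rule divergence_free_puncture[OF _ _ sing_sol_measurable(3) _ int(4) sing_flux_divergence_free \<phi>])
        (auto simp: sing_flux_def)
    finally show ?thesis .
  qed
  then have "weak_solution (ball 0 1) coefficient (sing_sol e)"
    using weak unfolding weak_solution_def W11_loc_def by blast
  moreover have "continuous_on (ball 0 1) (coefficient :: real^'n \<Rightarrow> real^'n^'n)"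
    using continuous_on_coefficient[OF assms] by (rule continuous_on_subset) auto
  ultimately show ?thesis
    using elliptic_coefficient[OF assms] sing_sol_not_AE_zero[OF e] trace W11 by blast
qed

end
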